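(* Let $D$ be a Platonic surface with Schläfli symbol $\{p,q\}$ and let $d=\gcd(p,q)$. The order of the cyclic group $\mathrm{Rot}(D)/\phi_D(\mathrm{Mon}(\pi_\Pi))$ is at most: - $d$, if $p$ and $q$ are both odd; - $2d$, if $p$ is odd and $q$ is even; - $d$, if $p\equiv 0 \pmod 4$ (any $q$); - $2d$, if $p\equiv 2\pmod 4$ and $q$ is odd; - $d$, if $p\equiv 2\pmod 4$ and $q$ is even.
   Context: **Platonic surfaces.** Let $p\ge 3$. Take finitely many congruent regular Euclidean $p$-gons (the faces) and glue their sides isometrically in pairs so that the result $D$ is a connected closed oriented surface. A flag is a triple $(f,e,v)$ with $f$ a face, $e$ one of the $p$ boundary sides of the polygon $f$ (if one edge of the surface occurs twice on the boundary of $f$, these are two different sides of $f$), and $v$ an endpoint of that side. An automorphism of $D$ is a Euclidean isometry of $D$ carrying faces to faces; $\mathrm{Aut}(D)$ acts on flags. $D$ is a Platonic surface if $\mathrm{Aut}(D)$ is transitive on flags. It has Schläfli symbol $\{p,q\}$ if every face has $p$ sides and every vertex has degree $q$. $\mathrm{Rot}(D)\le\mathrm{Aut}(D)$ is the subgroup of orientation-preserving automorphisms. **Unfolding.** $D$ minus its vertices is flat, and the holonomy of a closed curve in it is the change of angle when a tangent vector is parallel transported around the curve. The unfolding $\pi_D:\tilde D\to D$ is the smallest connected cover of $D$, branched only over vertices, such that every closed curve in $\tilde D$ avoiding the vertices has holonomy in $2\pi\mathbb{Z}$ (i.e. the completion of the covering of $D$ minus vertices corresponding to the kernel of the holonomy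 homomorphism to $\mathbb{R}/2\pi\mathbb{Z}$). $\tilde D$ is tiled by the lifts of the faces of $D$; directions are globally defined on $\tilde D$, and one fixes a horizontal direction on $\tilde D$ in which some side of some face is horizontal. **$\Pi_p$ and $\pi_\Pi$.** For $p$ even, $\Pi_p$ is a regular $p$-gon with a horizontal side whose opposite parallel sides are identified by translations. For $p$ odd, $\Pi_p$ is the union of a regular $p$-gon $P$ with a horizontal side and its rotation $-P$ by angle $\pi$, with each side of $P$ identified by translation with the parallel side of $-P$. Each face of $\tilde D$ is a translate of a unique polygon of $\Pi_p$, and $\pi_\Pi:\tilde D\to\Pi_p$ is the resulting branched covering, mapping each face by translation onto the corresponding polygon; it is branched only over vertices. **Monodromy group and $\phi_D$.** $\mathrm{Mon}(\pi_\Pi)$ is the image of the monodromy representation $\pi_1(\Pi_p\setminus\{\text{vertices}\},x_0)\to S_n$, $n=\deg\pi_\Pi$, recording how lifts of loops permute the sheets of $\pi_\Pi$. It is a known theorem that $\tilde D$ (forgetting the horizontal direction) is a Platonic surface and that $\pi_\Pi$ is a normal covering; hence $\mathrm{Mon}(\pi_\Pi)$ is isomorphic to, and is identified with, the deck group of $\pi_\Pi$, a subgroup of $\mathrm{Rot}(\tilde D)$. The homomorphism $\phi_D:\mathrm{Rot}(\tilde D)\to\mathrm{Rot}(D)$ sends $\tilde F$ to the unique $F$ with $\pi_D\circ\tilde F=F\circ\pi_D$. The subgroup $\phi_D(\mathrm{Mon}(\pi_\Pi))$ is normal in $\mathrm{Rot}(D)$ with cyclic quotient. *)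

theory Defs
  imports "HOL-Analysis.Analysis" "HOL-Algebra.Coset" "HOL-Algebra.Bij"
begin

section \<open>The model regular polygon\<close>

text \<open>The circumradius is normalised to 1. Corners are numbered counterclockwise from the left
  end of the bottom side, so that side 0 is horizontal; the index may be read modulo \<open>p\<close>.
  Side \<open>k\<close> runs from corner \<open>k\<close> to corner \<open>Suc k\<close>.\<close>

definition corner :: "nat \<Rightarrow> nat \<Rightarrow> complex" where
  "corner p k = cis (2 * pi * real k / real p - pi / 2 - pi / real p)"

definition edge_vec :: "nat \<Rightarrow> nat \<Rightarrow> complex" where
  "edge_vec p k = corner p (Suc k) - corner p k"

definition regular_polygon :: "nat \<Rightarrow> complex set" where
  "regular_polygon p = convex hull (corner p ` {..<p})"


section \<open>Surfaces glued from regular polygons\<close>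

text \<open>Each face of an oriented surface has an orientation-preserving isometric chart onto the model
  polygon, so a surface is given by its set of faces and the pairing of the sides \<open>(f, k)\<close>.
  Compatibility with the orientations of the faces forces paired sides to be glued with reversed
  direction.\<close>

record 'f poly_surface =
  gon :: nat
  faces :: "'f set"
  glue :: "'f \<times> nat \<Rightarrow> 'f \<times> nat"

definition sides :: "'f poly_surface \<Rightarrow> ('f \<times> nat) set" where
  "sides D = faces D \<times> {..<gon D}"

text \<open>A gallery starts in a face and successively crosses the listed sides; it is the
  combinatorial form of a curve avoiding the vertices. Every such curve is homotopic, in the
  complement of the vertices, to a gallery.\<close>

fun gallery :: "'f poly_surface \<Rightarrow> 'f \<Rightarrow> ('f \<times> nat) list \<Rightarrow> 'f \<Rightarrow> bool" where
  "gallery D f [] g \<longleftrightarrow> f \<in> faces D \<and> f = g"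
| "gallery D f (s # ss) g \<longleftrightarrow> s \<in> sides D \<and> fst s = f \<and> gallery D (fst (glue D s)) ss g"

text \<open>The quotient of a polygon gluing of this kind is automatically a closed oriented surface.\<close>

definition polygonal_surface :: "'f poly_surface \<Rightarrow> bool" where
  "polygonal_surface D \<longleftrightarrow>
     3 \<le> gon D \<and> finite (faces D) \<and> faces D \<noteq> {} \<and>
     (\<forall>s\<in>sides D. glue D s \<in> sides D \<and> glue D s \<noteq> s \<and> glue D (glue D s) = s) \<and>
     (\<forall>f\<in>faces D. \<forall>g\<in>faces D. \<exists>ss. gallery D f ss g)"

definition glue_rel :: "'f poly_surface \<Rightarrow> (('f \<times> complex) \<times> ('f \<times> complex)) set" where
  "glue_rel D =
     {((f, linepath (corner (gon D) k) (corner (gon D) (Suc k)) t),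
       (f', linepath (corner (gon D) (Suc k')) (corner (gon D) k') t)) | f k f' k' t.
       (f, k) \<in> sides D \<and> (f', k') = glue D (f, k) \<and> t \<in> {0..1}}"

text \<open>\<open>pt D (f, z)\<close> is the point of the surface with chart coordinate \<open>z\<close> in the face \<open>f\<close>;
  the relation \<^const>\<open>glue_rel\<close> is symmetric since the pairing is an involution.\<close>

definition pt :: "'f poly_surface \<Rightarrow> 'f \<times> complex \<Rightarrow> ('f \<times> complex) set" where
  "pt D a = (glue_rel D)\<^sup>* `` {a}"

definition points :: "'f poly_surface \<Rightarrow> ('f \<times> complex) set set" where
  "points D = pt D ` (faces D \<times> regular_polygon (gon D))"


section \<open>Automorphisms, Platonic surfaces\<close>

definition plane_isometry :: "(complex \<Rightarrow> complex) \<Rightarrow> bool" where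
  "plane_isometry g \<longleftrightarrow> (\<forall>z w. dist (g z) (g w) = dist z w)"

definition orientation_preserving :: "(complex \<Rightarrow> complex) \<Rightarrow> bool" where
  "orientation_preserving g \<longleftrightarrow> (\<exists>a b. g = (\<lambda>z. a * z + b))"

text \<open>\<open>F\<close> carries the face \<open>f\<close> to the face \<open>f'\<close>, and is the Euclidean isometry \<open>g\<close> in the charts.\<close>

definition carries_face :: "'f poly_surface \<Rightarrow> (('f \<times> complex) set \<Rightarrow> ('f \<times> complex) set) \<Rightarrow>
    'f \<Rightarrow> 'f \<Rightarrow> (complex \<Rightarrow> complex) \<Rightarrow> bool" where
  "carries_face D F f f' g \<longleftrightarrow>
     f' \<in> faces D \<and> plane_isometry g \<and> g ` regular_polygon (gon D) = regular_polygon (gon D) \<and>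
     (\<forall>z\<in>regular_polygon (gon D). F (pt D (f, z)) = pt D (f', g z))"

definition automorphisms :: "'f poly_surface \<Rightarrow> (('f \<times> complex) set \<Rightarrow> ('f \<times> complex) set) set" where
  "automorphisms D = {F \<in> Bij (points D). \<forall>f\<in>faces D. \<exists>f' g. carries_face D F f f' g}"

definition Aut :: "'f poly_surface \<Rightarrow> (('f \<times> complex) set \<Rightarrow> ('f \<times> complex) set) monoid" where
  "Aut D = (BijGroup (points D))\<lparr>carrier := automorphisms D\<rparr>"

definition Rot :: "'f poly_surface \<Rightarrow> (('f \<times> complex) set \<Rightarrow> ('f \<times> complex) set) monoid" where
  "Rot D = (BijGroup (points D))\<lparr>carrier :=
     {F \<in> automorphisms D. \<forall>f\<in>faces D. \<exists>f' g. carries_face D F f f' g \<and> orientation_preserving g}\<rparr>"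

text \<open>A flag \<open>(f, k, v)\<close> consists of a face, the number of a side of its polygon, and an endpoint
  of that side (in the chart). Keeping track of the side in the chart, rather than of its image in
  the surface, distinguishes the two occurrences of an edge that lies twice on one face.\<close>

definition flags :: "'f poly_surface \<Rightarrow> ('f \<times> nat \<times> complex) set" where
  "flags D = {(f, k, v). (f, k) \<in> sides D \<and> v \<in> {corner (gon D) k, corner (gon D) (Suc k)}}"

definition carries_flag :: "'f poly_surface \<Rightarrow> (('f \<times> complex) set \<Rightarrow> ('f \<times> complex) set) \<Rightarrow>
    'f \<times> nat \<times> complex \<Rightarrow> 'f \<times> nat \<times> complex \<Rightarrow> bool" where
  "carries_flag D F = (\<lambda>(f, k, v) (f', k', v'). \<exists>g. carries_face D F f f' g \<and>
     g ` closed_segment (corner (gon D) k) (corner (gon D) (Suc k)) =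
       closed_segment (corner (gon D) k') (corner (gon D) (Suc k')) \<and> g v = v')"

definition platonic_surface :: "'f poly_surface \<Rightarrow> bool" where
  "platonic_surface D \<longleftrightarrow> polygonal_surface D \<and>
     (\<forall>a\<in>flags D. \<forall>b\<in>flags D. \<exists>F\<in>carrier (Aut D). carries_flag D F a b)"

definition vertices :: "'f poly_surface \<Rightarrow> ('f \<times> complex) set set" where
  "vertices D = {pt D (f, corner (gon D) k) | f k. (f, k) \<in> sides D}"

text \<open>The number of edge ends at \<open>x\<close>: every edge end at \<open>x\<close> is the initial end of exactly one
  counterclockwise oriented side \<open>(f, k)\<close>.\<close>

definition vertex_degree :: "'f poly_surface \<Rightarrow> ('f \<times> complex) set \<Rightarrow> nat" where
  "vertex_degree D x = card {(f, k). (f, k) \<in> sides D \<and> pt D (f, corner (gon D) k) = x}"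

definition schlafli_symbol :: "'f poly_surface \<Rightarrow> nat \<Rightarrow> nat \<Rightarrow> bool" where
  "schlafli_symbol D p q \<longleftrightarrow> gon D = p \<and> (\<forall>x\<in>vertices D. vertex_degree D x = q)"


section \<open>Holonomy and the unfolding\<close>

text \<open>Parallel transport across the side \<open>(f, k)\<close>, glued to \<open>(f', k')\<close>, multiplies the chart
  coordinate of a tangent vector by the linear part of the change of charts, that is by the
  unimodular number taking the direction of side \<open>k\<close> to the opposite of the direction of side
  \<open>k'\<close>. The holonomy angle of a closed gallery is an argument of its \<open>transport\<close>, so holonomy in
  \<open>2\<pi>\<int>\<close> means transport 1.\<close>

definition turn :: "'f poly_surface \<Rightarrow> 'f \<times> nat \<Rightarrow> complex" where
  "turn D s = - edge_vec (gon D) (snd (glue D s)) / edge_vec (gon D) (snd s)"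

definition transport :: "'f poly_surface \<Rightarrow> ('f \<times> nat) list \<Rightarrow> complex" where
  "transport D ss = prod_list (map (turn D) ss)"

text \<open>The cover belonging to the kernel of the holonomy: its faces are the galleries issuing from
  a base face \<open>f0\<close>, two of them being identified if they have the same end \<open>f\<close> and the closed
  gallery formed by one and the reverse of the other has trivial holonomy, that is if they have the
  same transport \<open>h\<close>. The pair \<open>(f, h)\<close> stands for this class; a side is crossed by prolonging
  the gallery. Gluing closed polygons completes the cover over the vertices.\<close>

definition unfolding_surface :: "'f poly_surface \<Rightarrow> 'f \<Rightarrow> ('f \<times> complex) poly_surface" where
  "unfolding_surface D f0 =
     \<lparr>gon = gon D,
      faces = {(f, h). \<exists>ss. gallery D f0 ss f \<and> transport D ss = h},
      glue = (\<lambda>((f, h), k). ((fst (glue D (f, k)), h * turn D (f, k)), snd (glue D (f, k))))\<rparr>"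

definition proj_D :: "'f poly_surface \<Rightarrow> (('f \<times> complex) \<times> complex) set \<Rightarrow> ('f \<times> complex) set" where
  "proj_D D X = the_elem ((\<lambda>((f, h), z). pt D (f, z)) ` X)"

text \<open>A choice of horizontal direction on the unfolding is a unimodular number \<open>c\<close>: the tangent
  vector \<open>w\<close> in the chart of the base face points in the global direction \<open>c * w\<close>. Then a vector
  \<open>w\<close> in the chart of the face \<open>x = (f, h)\<close> points in the global direction \<open>heading c x * w\<close>.\<close>

definition heading :: "complex \<Rightarrow> 'f \<times> complex \<Rightarrow> complex" where
  "heading c x = c / snd x"

definition horizontal_choice :: "'f poly_surface \<Rightarrow> 'f \<Rightarrow> complex \<Rightarrow> bool" where
  "horizontal_choice D f0 c \<longleftrightarrow> cmod c = 1 \<and>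
     (\<exists>(x, k)\<in>sides (unfolding_surface D f0). Im (heading c x * edge_vec (gon D) k) = 0)"


section \<open>The surface \<open>\<Pi>\<^sub>p\<close> and the covering by translations\<close>

text \<open>The face \<open>s\<close> of \<open>Pi_surface p\<close> is the polygon \<open>s * regular_polygon p\<close> in the plane, its
  chart being division by \<open>s\<close>; thus side \<open>k\<close> of \<open>-P\<close> is the negative of side \<open>k\<close> of \<open>P\<close>. For
  even \<open>p\<close> the sides \<open>k\<close> and \<open>k + p div 2\<close> are parallel.\<close>

definition Pi_surface :: "nat \<Rightarrow> complex poly_surface" where
  "Pi_surface p =
     \<lparr>gon = p,
      faces = (if even p then {1} else {1, -1}),
      glue = (\<lambda>(s, k). if even p then (s, (k + p div 2) mod p) else (- s, k))\<rparr>"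

text \<open>The unique polygon of \<open>\<Pi>\<^sub>p\<close> of which the face \<open>x\<close> is a translate; all polygons here are
  placed with their centres at the origin.\<close>

definition Pi_face :: "nat \<Rightarrow> complex \<Rightarrow> 'f \<times> complex \<Rightarrow> complex" where
  "Pi_face p c x = (THE s. s \<in> faces (Pi_surface p) \<and>
     (*) (heading c x) ` regular_polygon p = (*) s ` regular_polygon p)"

definition proj_Pi :: "nat \<Rightarrow> complex \<Rightarrow> (('f \<times> complex) \<times> complex) set \<Rightarrow> (complex \<times> complex) set" where
  "proj_Pi p c X =
     the_elem ((\<lambda>(x, z). pt (Pi_surface p) (Pi_face p c x, heading c x * z / Pi_face p c x)) ` X)"

definition Pi_side :: "nat \<Rightarrow> complex \<Rightarrow> ('f \<times> complex) \<times> nat \<Rightarrow> complex \<times> nat" where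
  "Pi_side p c = (\<lambda>(x, j). (Pi_face p c x,
     THE k. k < p \<and> heading c x * corner p j = Pi_face p c x * corner p k))"


section \<open>The monodromy group and \<open>\<phi>\<^sub>D\<close>\<close>

text \<open>The base point is the centre of the polygon \<open>P\<close> of \<open>\<Pi>\<^sub>p\<close>; the points over it are the
  centres of the translates of \<open>P\<close>, and these faces represent the sheets. Loops are closed
  galleries, and are lifted to galleries of the unfolding.\<close>

definition sheets :: "'f poly_surface \<Rightarrow> 'f \<Rightarrow> complex \<Rightarrow> ('f \<times> complex) set" where
  "sheets D f0 c = {x \<in> faces (unfolding_surface D f0). Pi_face (gon D) c x = 1}"

definition monodromy :: "'f poly_surface \<Rightarrow> 'f \<Rightarrow> complex \<Rightarrow> (complex \<times> nat) list \<Rightarrow>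
    'f \<times> complex \<Rightarrow> 'f \<times> complex" where
  "monodromy D f0 c ws = (\<lambda>x\<in>sheets D f0 c. THE y.
     \<exists>ss. gallery (unfolding_surface D f0) x ss y \<and> map (Pi_side (gon D) c) ss = ws)"

definition Mon :: "'f poly_surface \<Rightarrow> 'f \<Rightarrow> complex \<Rightarrow> ('f \<times> complex \<Rightarrow> 'f \<times> complex) set" where
  "Mon D f0 c = monodromy D f0 c ` {ws. gallery (Pi_surface (gon D)) 1 ws 1}"

definition deck :: "'f poly_surface \<Rightarrow> 'f \<Rightarrow> complex \<Rightarrow>
    ((('f \<times> complex) \<times> complex) set \<Rightarrow> (('f \<times> complex) \<times> complex) set) set" where
  "deck D f0 c = {F \<in> carrier (Rot (unfolding_surface D f0)).
     \<forall>X\<in>points (unfolding_surface D f0). proj_Pi (gon D) c (F X) = proj_Pi (gon D) c X}"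

text \<open>The identification of the monodromy group of a normal covering with its deck group depends
  on a base sheet \<open>y\<close>: the permutation \<open>\<mu>\<close> corresponds to the deck transformation which moves the
  base sheet as \<open>\<mu>\<close> does.\<close>

definition deck_of :: "'f poly_surface \<Rightarrow> 'f \<Rightarrow> complex \<Rightarrow> 'f \<times> complex \<Rightarrow>
    ('f \<times> complex \<Rightarrow> 'f \<times> complex) \<Rightarrow>
    ((('f \<times> complex) \<times> complex) set \<Rightarrow> (('f \<times> complex) \<times> complex) set)" where
  "deck_of D f0 c y \<mu> = (THE F. F \<in> deck D f0 c \<and>
     F (pt (unfolding_surface D f0) (y, 0)) = pt (unfolding_surface D f0) (\<mu> y, 0))"

definition phi :: "'f poly_surface \<Rightarrow> 'f \<Rightarrow>
    ((('f \<times> complex) \<times> complex) set \<Rightarrow> (('f \<times> complex) \<times> complex) set) \<Rightarrow>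
    (('f \<times> complex) set \<Rightarrow> ('f \<times> complex) set)" where
  "phi D f0 F = (THE G. G \<in> carrier (Rot D) \<and>
     (\<forall>X\<in>points (unfolding_surface D f0). proj_D D (F X) = G (proj_D D X)))"

definition Rot_mod_Mon :: "'f poly_surface \<Rightarrow> 'f \<Rightarrow> complex \<Rightarrow> 'f \<times> complex \<Rightarrow>
    (('f \<times> complex) set \<Rightarrow> ('f \<times> complex) set) set monoid" where
  "Rot_mod_Mon D f0 c y = Rot D Mod (phi D f0 ` deck_of D f0 c y ` Mon D f0 c)"

end

theory Submission
  imports Defs
begin

text \<open>
  A rotation of \<open>D\<close> permutes the faces and shifts the sides of each of them cyclically. Let it carry
  the face \<open>f\<close> to \<open>f'\<close> with shift \<open>a\<close>, and let \<open>t\<close> be the parallel transport along some gallery from \<open>f\<close>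
  to \<open>f'\<close>. Put \<open>\<zeta> = cis (2 * pi / p)\<close>. The number \<open>t / \<zeta> ^ a\<close> lies in the group generated by \<open>- 1\<close> and
  \<open>\<zeta>\<close>, and it is well defined modulo the holonomy group. Every rotation lifts to the unfolding; the
  lifts turn the global directions exactly by these numbers, up to inversion, so the rotation comes
  from a deck transformation of \<open>\<pi>\<^sub>\<Pi>\<close> if and only if the holonomy group contains \<open>t / \<zeta> ^ a\<close>. Hence
  the quotient embeds into the group generated by \<open>- 1\<close> and \<open>\<zeta>\<close> modulo holonomy. A small loop
  around a vertex has holonomy \<open>(- \<zeta>) ^ q\<close>, and the bounds are the indices of the subgroup generated
  by this element.
\<close>

section \<open>Geometry of the regular polygon\<close>

text \<open>Glued sides run in opposite directions, so crossing a side contributes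
  \<open>- 1\<close> besides a power of \<open>\<zeta>\<close>; this sign causes the dependence on
  parities. For odd \<open>p\<close> the group of all values is cyclic of order \<open>2 * p\<close>
  with generator \<open>- \<zeta>\<close>; for even \<open>p\<close> it is cyclic of order
  \<open>p\<close> with generator \<open>\<zeta>\<close>, and
  \<open>- \<zeta> = \<zeta> ^ (1 + p div 2)\<close>. The two indices are therefore
  \<open>gcd q (2 * p)\<close> and \<open>gcd ((1 + p div 2) * q) p\<close>, and the five cases
  evaluate or bound these. The main obstacle is that an automorphism is only a bijection of points
  which is some isometry on each face, chosen face by face. That it respects the pairing of the
  sides is extracted from inner points of sides: such a point has exactly two chart representatives,
  one on each of the paired sides. Conversely, rotations with a prescribed effect on one face must
  be produced, both for deck transformations and for comparing cosets; flag transitivity provides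
  them.\<close>

definition root_of_unity :: "nat \<Rightarrow> complex" where
  "root_of_unity p = cis (2 * pi / real p)"

lemma corner_conv_power: "corner p k = corner p 0 * root_of_unity p ^ k"
proof -
  have "corner p k = cis (- pi / 2 - pi / real p) * cis (real k * (2 * pi / real p))"
    unfolding corner_def cis_mult by (rule arg_cong[where f = cis]) (simp add: field_simps)
  then show ?thesis
    by (simp add: corner_def root_of_unity_def Complex.DeMoivre)
qed

lemma norm_corner [simp]: "norm (corner p k) = 1"
  by (simp add: corner_def)

lemma corner_nonzero [simp]: "corner p k \<noteq> 0"
  using norm_corner[of p k] by force

lemma norm_root_of_unity [simp]: "norm (root_of_unity p) = 1"
  by (simp add: root_of_unity_def)

lemma root_of_unity_nonzero [simp]: "root_of_unity p \<noteq> 0"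
  by (simp add: root_of_unity_def)

lemma root_of_unity_power_gon: "0 < p \<Longrightarrow> root_of_unity p ^ p = 1"
  by (simp add: root_of_unity_def Complex.DeMoivre)

lemma root_of_unity_power_power: "0 < p \<Longrightarrow> (root_of_unity p ^ k) ^ p = 1"
  using root_of_unity_power_gon[of p] by (metis power_mult mult.commute power_one)

text \<open>Bridge between indices modulo \<open>p\<close> and powers of \<open>\<zeta>\<close>: a
  common shift is then cancelled by dividing by a nonzero number.\<close>

lemma root_of_unity_power_eq_iff:
  assumes "0 < p"
  shows "root_of_unity p ^ j = root_of_unity p ^ k \<longleftrightarrow> j mod p = k mod p"
proof -
  have "root_of_unity p ^ j = exp (2 * of_real pi * \<i> * of_nat j / of_nat p)" for j
    by (simp add: root_of_unity_def cis_conv_exp exp_of_nat_mult[symmetric] mult_ac)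
  then show ?thesis
    using complex_root_unity_eq[of p j k] assms by simp
qed

lemma root_of_unity_power_mod: "0 < p \<Longrightarrow> root_of_unity p ^ (k mod p) = root_of_unity p ^ k"
  by (simp add: root_of_unity_power_eq_iff)

lemma ex_root_of_unity_power:
  assumes "0 < p" "u ^ p = 1"
  shows "\<exists>k<p. u = root_of_unity p ^ k"
proof -
  have "u \<in> {z. z ^ p = 1}" using assms by simp
  then obtain j where "j < p" "u = exp (2 * of_real pi * \<i> * of_nat j / of_nat p)"
    using complex_roots_unity[of p] assms(1) by auto
  then have "u = root_of_unity p ^ j"
    by (simp add: root_of_unity_def cis_conv_exp exp_of_nat_mult[symmetric] mult_ac)
  with \<open>j < p\<close> show ?thesis by blast
qed

lemma corner_add: "corner p (j + k) = root_of_unity p ^ k * corner p j"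
  by (simp add: corner_conv_power[of p "j + k"] corner_conv_power[of p j] power_add)

lemma corner_eq_iff: "0 < p \<Longrightarrow> corner p j = corner p k \<longleftrightarrow> j mod p = k mod p"
  by (simp add: corner_conv_power[of p j] corner_conv_power[of p k] root_of_unity_power_eq_iff)

lemma corner_mod: "0 < p \<Longrightarrow> corner p (k mod p) = corner p k"
  by (simp add: corner_eq_iff)

lemma corner_Suc_mod: "0 < p \<Longrightarrow> corner p (Suc (k mod p)) = corner p (Suc k)"
  by (simp add: corner_eq_iff mod_Suc_eq)

lemma edge_vec_add: "edge_vec p (j + k) = root_of_unity p ^ k * edge_vec p j"
  using corner_add[of p "Suc j" k] corner_add[of p j k]
  by (simp add: edge_vec_def algebra_simps)

lemma corner_0: "corner p 0 = - \<i> * cis (- pi / p)"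
  and corner_1: "corner p (Suc 0) = - \<i> * cis (pi / p)"
proof -
  have "- \<i> = cis (- pi / 2)" by (simp add: complex_eq_iff)
  then show "corner p 0 = - \<i> * cis (- pi / p)" "corner p (Suc 0) = - \<i> * cis (pi / p)"
    unfolding corner_def by (simp_all only: cis_mult) (rule arg_cong[where f = cis], simp add: field_simps)+
qed

lemma edge_vec_0: "edge_vec p 0 = of_real (2 * sin (pi / p))"
  by (simp add: edge_vec_def corner_0 corner_1 complex_eq_iff)

text \<open>The inradius is \<open>cos (pi / p)\<close>; the bound 1/2 is its value for the triangle
  and keeps all sides away from the centre.\<close>

lemma polygon_angle:
  assumes "3 \<le> p"
  shows "0 < sin (pi / real p)" "1 / 2 \<le> cos (pi / real p)" "0 < pi / real p" "pi / real p \<le> pi / 3"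
proof -
  show *: "0 < pi / real p" "pi / real p \<le> pi / 3"
    using assms by (auto simp: field_simps)
  show "0 < sin (pi / real p)" using * pi_gt_zero by (intro sin_gt_zero) linarith+
  have "cos (pi / 3) \<le> cos (pi / real p)"
    using * pi_gt_zero by (intro cos_monotone_0_pi_le) linarith+
  then show "1 / 2 \<le> cos (pi / real p)" by (simp add: cos_60)
qed

lemma edge_vec_conv_power: "edge_vec p k = edge_vec p 0 * root_of_unity p ^ k"
  using edge_vec_add[of p 0 k] by simp

lemma edge_vec_nonzero: "3 \<le> p \<Longrightarrow> edge_vec p k \<noteq> 0"
  using polygon_angle(1)[of p] by (simp add: edge_vec_conv_power[of p k] edge_vec_0)

section \<open>Points on the sides\<close>

definition side_point :: "nat \<Rightarrow> nat \<Rightarrow> real \<Rightarrow> complex" where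
  "side_point p k t = linepath (corner p k) (corner p (Suc k)) t"

lemma side_point_add: "side_point p (j + k) t = root_of_unity p ^ k * side_point p j t"
  using corner_add[of p "Suc j" k] corner_add[of p j k]
  by (simp add: side_point_def linepath_def algebra_simps)

lemma side_point_mod: "0 < p \<Longrightarrow> side_point p (k mod p) t = side_point p k t"
  by (simp add: side_point_def corner_mod corner_Suc_mod)

lemma side_point_reverse: "linepath (corner p (Suc k)) (corner p k) t = side_point p k (1 - t)"
  by (simp add: side_point_def linepath_def algebra_simps)

lemma side_point_0 [simp]: "side_point p k 0 = corner p k"
  and side_point_1 [simp]: "side_point p k 1 = corner p (Suc k)"
  by (simp_all add: side_point_def linepath_def)

text \<open>Up to a rotation every side is the vertical chord at distance
  \<open>cos (pi / p)\<close> from the centre, of half-length \<open>sin (pi / p)\<close>, with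
  \<open>t = 1 / 2\<close> at its midpoint.\<close>

lemma side_point_conv_power: "side_point p k t = root_of_unity p ^ k *
    (- \<i> * Complex (cos (pi / p)) ((2 * t - 1) * sin (pi / p)))"
  using side_point_add[of p 0 k t]
  by (simp add: side_point_def linepath_def corner_0 corner_1 complex_eq_iff algebra_simps scaleR_conv_of_real)

lemma norm_side_point: "(norm (side_point p k t))\<^sup>2 =
    (cos (pi / p))\<^sup>2 + ((2 * t - 1) * sin (pi / p))\<^sup>2"
  unfolding side_point_conv_power
  by (simp add: norm_mult norm_power power_mult_distrib del: complex_norm) (simp add: cmod_power2 power_mult_distrib)

lemma norm_side_point_ge:
  assumes "3 \<le> p"
  shows "1 / 2 \<le> norm (side_point p k t)"
proof (rule power2_le_imp_le)
  have "(1 / 2)\<^sup>2 \<le> (cos (pi / p))\<^sup>2"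
    using polygon_angle(2)[OF assms] by (intro power_mono) auto
  then show "(1 / 2)\<^sup>2 \<le> (norm (side_point p k t))\<^sup>2"
    unfolding norm_side_point by (smt (verit) zero_le_power2)
qed auto

lemma norm_side_point_less:
  assumes "3 \<le> p" "0 < t" "t < 1"
  shows "norm (side_point p k t) < 1"
proof (rule power2_less_imp_less)
  have "(2 * t - 1)\<^sup>2 < 1" using assms by (simp add: abs_square_less_1)
  then have "((2 * t - 1) * sin (pi / p))\<^sup>2 < (sin (pi / p))\<^sup>2"
    using polygon_angle(1)[OF assms(1)] by (simp add: power_mult_distrib)
  then show "(norm (side_point p k t))\<^sup>2 < 1\<^sup>2"
    unfolding norm_side_point one_power2 using sin_cos_squared_add2[of "pi / p"] by linarith
qed auto

text \<open>Equal norms determine \<open>2 * t - 1\<close> up to sign. In the mirrored case the two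
  points are a root of unity times \<open>w\<close> and times \<open>cnj w\<close>; taking
  \<open>p\<close>-th powers shows that \<open>w ^ p\<close> is real, and the argument of
  \<open>w\<close> is so small that \<open>w\<close> itself is real, which makes the point a
  midpoint.\<close>

lemma side_point_eqD:
  assumes p: "3 \<le> p" and t: "0 < t" "t < 1" and eq: "side_point p j s = side_point p k t"
  shows "s = t" "j mod p = k mod p"
proof -
  define C where "C = cos (pi / p)"
  define S where "S = sin (pi / p)"
  define w where "w = Complex C ((2 * t - 1) * S)"
  have C: "0 < C" and S: "0 < S" using polygon_angle[OF p] by (auto simp: C_def S_def)
  have eq': "root_of_unity p ^ j * Complex C ((2 * s - 1) * S) = root_of_unity p ^ k * w"
    using eq unfolding side_point_conv_power w_def C_def S_def by simp
  have w: "w \<noteq> 0" using C by (simp add: w_def complex_eq_iff)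
  have "((2 * s - 1) * S)\<^sup>2 = ((2 * t - 1) * S)\<^sup>2"
    using arg_cong[OF eq, of "\<lambda>z. (norm z)\<^sup>2"] unfolding norm_side_point S_def by simp
  then have "2 * s - 1 = 2 * t - 1 \<or> 2 * s - 1 = - (2 * t - 1)"
    using S by (simp add: power2_eq_iff power_mult_distrib)
  moreover have "s = t" if *: "2 * s - 1 = - (2 * t - 1)"
  proof -
    have "Complex C ((2 * s - 1) * S) = cnj w" unfolding * by (simp add: w_def complex_eq_iff algebra_simps)
    then have "(root_of_unity p ^ j * cnj w) ^ p = (root_of_unity p ^ k * w) ^ p" using eq' by simp
    moreover have "(root_of_unity p ^ i) ^ p = 1" for i
      using root_of_unity_power_power[of p] p by simp
    ultimately have "cnj (w ^ p) = w ^ p" by (simp add: power_mult_distrib)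
    then have Im: "Im (w ^ p) = 0" by (metis Im_complex_of_real Reals_cases Reals_cnj_iff)
    \<comment> \<open>The argument of \<open>w\<close>. It lies strictly between
      \<open>- (pi / p)\<close> and \<open>pi / p\<close>, so \<open>p * \<theta>\<close> is a zero
      of \<open>sin\<close> strictly between \<open>- pi\<close> and \<open>pi\<close>.\<close>
    define \<theta> where "\<theta> = arctan ((2 * t - 1) * S / C)"
    have cpos: "0 < cos \<theta>" unfolding \<theta>_def by (simp add: cos_arctan add_pos_nonneg)
    have "tan \<theta> = (2 * t - 1) * S / C" by (simp add: \<theta>_def tan_arctan)
    then have "sin \<theta> * C = (2 * t - 1) * S * cos \<theta>"
      using cpos C by (simp add: tan_def field_simps)
    then have w\<theta>: "w = of_real (C / cos \<theta>) * cis \<theta>"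
      using cpos by (simp add: w_def complex_eq_iff field_simps)
    have "w ^ p = of_real ((C / cos \<theta>) ^ p) * cis (real p * \<theta>)"
      unfolding w\<theta> power_mult_distrib Complex.DeMoivre by simp
    then have "sin (real p * \<theta>) = 0" using Im C cpos by simp
    have "arctan (tan (pi / p)) = pi / p"
      using polygon_angle(3,4)[OF p] pi_gt_zero by (intro arctan_tan) linarith+
    then have tanp: "arctan (S / C) = pi / p" by (simp add: S_def C_def tan_def)
    have "(2 * t - 1) * S / C < S / C" "- (S / C) < (2 * t - 1) * S / C"
      using t S C by (auto simp: field_simps)
    then have "\<theta> < pi / p" "- (pi / p) < \<theta>"
      unfolding \<theta>_def using tanp by (metis arctan_less_iff, metis arctan_less_iff arctan_minus)
    then have "real p * \<theta> < pi" "- pi < real p * \<theta>" using p by (auto simp: field_simps)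
    with \<open>sin (real p * \<theta>) = 0\<close> have "real p * \<theta> = 0" using sin_eq_0_pi by blast
    then have "\<theta> = 0" using p by simp
    then have "(2 * t - 1) * S / C = 0" unfolding \<theta>_def by simp
    then show "s = t" using S C * by simp
  qed
  ultimately show st: "s = t" by auto
  have "root_of_unity p ^ j = root_of_unity p ^ k"
    using eq' w by (simp add: st w_def)
  then show "j mod p = k mod p" using p by (simp add: root_of_unity_power_eq_iff)
qed

section \<open>The polygon as a convex set, and its isometries\<close>

lemma sum_corners:
  assumes "3 \<le> p"
  shows "(\<Sum>k<p. corner p k) = 0"
proof -
  have "root_of_unity p ^ 1 \<noteq> root_of_unity p ^ 0"
    using assms by (subst root_of_unity_power_eq_iff) auto
  then have "(\<Sum>k<p. root_of_unity p ^ k) = 0"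
    using assms by (simp add: geometric_sum root_of_unity_power_gon)
  moreover have "(\<Sum>k<p. corner p k) = (\<Sum>k<p. corner p 0 * root_of_unity p ^ k)"
    by (intro sum.cong refl corner_conv_power)
  ultimately show ?thesis by (simp add: sum_distrib_left[symmetric])
qed

lemma corner_in_polygon:
  assumes "0 < p"
  shows "corner p k \<in> regular_polygon p"
proof -
  have "corner p k \<in> corner p ` {..<p}"
    using corner_mod[OF assms, of k] assms by (intro image_eqI[of _ _ "k mod p"]) auto
  then show ?thesis unfolding regular_polygon_def by (rule hull_inc)
qed

lemma convex_regular_polygon: "convex (regular_polygon p)"
  by (simp add: regular_polygon_def)

lemma zero_in_polygon:
  assumes "3 \<le> p"
  shows "0 \<in> regular_polygon p"
proof -
  have "(\<Sum>k\<in>{..<p}. (1 / real p) *\<^sub>R corner p k) \<in> regular_polygon p"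
    using assms by (intro convex_sum convex_regular_polygon corner_in_polygon) auto
  then show ?thesis by (simp add: scaleR_sum_right[symmetric] sum_corners[OF assms])
qed

lemma side_point_in_polygon:
  assumes "0 < p" "0 \<le> t" "t \<le> 1"
  shows "side_point p k t \<in> regular_polygon p"
  using convexD[OF convex_regular_polygon corner_in_polygon corner_in_polygon, OF assms(1) assms(1), of "1 - t" t] assms
  by (simp add: side_point_def linepath_def)

lemma norm_in_polygon_le:
  assumes "z \<in> regular_polygon p"
  shows "norm z \<le> 1"
proof -
  have "regular_polygon p \<subseteq> cball 0 1"
    unfolding regular_polygon_def by (intro hull_minimal) auto
  then show ?thesis using assms by auto
qed

text \<open>By strict Cauchy-Schwarz, a unit vector \<open>z\<close> that is no corner has inner
  product less than 1 with every corner. The open half-plane where \<open>inner z x < 1\<close> then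
  contains the polygon but not \<open>z\<close>.\<close>

lemma norm_1_in_polygon:
  assumes z: "z \<in> regular_polygon p" "norm z = 1"
  shows "\<exists>k<p. z = corner p k"
proof (rule ccontr)
  assume "\<not> ?thesis"
  then have ne: "corner p k \<noteq> z" if "k < p" for k using that by auto
  have "inner z (corner p k) < 1" if "k < p" for k
  proof -
    have "inner z (corner p k) \<le> 1"
      using norm_cauchy_schwarz[of z "corner p k"] z by simp
    moreover have "inner z (corner p k) \<noteq> 1"
    proof
      assume "inner z (corner p k) = 1"
      then have "(norm (z - corner p k))\<^sup>2 = 0"
        unfolding power2_norm_eq_inner inner_diff_left inner_diff_right
        using z(2) norm_corner[of p k] by (simp add: inner_commute norm_eq_1 del: norm_corner)
      then show False using ne[OF that] by simp
    qed
    ultimately show ?thesis by simp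
  qed
  then have "regular_polygon p \<subseteq> {x. inner z x < 1}"
    unfolding regular_polygon_def by (intro hull_minimal convex_halfspace_lt) auto
  then show False using z norm_eq_1[of z] by auto
qed

text \<open>The centre is the only point at distance at most 1 from all corners.\<close>

lemma polygon_isometry_fixes_0:
  assumes p: "3 \<le> p" and g: "plane_isometry g" "g ` regular_polygon p = regular_polygon p"
  shows "g 0 = 0"
proof -
  define b where "b = g 0"
  have "(norm (corner p k - b))\<^sup>2 \<le> 1" for k
  proof -
    obtain x where x: "x \<in> regular_polygon p" "corner p k = g x"
      using g(2) corner_in_polygon[of p k] p by auto
    have "norm (corner p k - b) = norm x"
      using g(1) unfolding x(2) b_def plane_isometry_def by (metis dist_norm diff_zero)
    then show ?thesis using norm_in_polygon_le[OF x(1)] by (simp add: power_le_one)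
  qed
  \<comment> \<open>In the sum of the squared distances the mixed terms cancel because the corners
    add up to 0; what remains is \<open>p + p * (norm b)\<^sup>2 \<le> p\<close>.\<close>
  then have "(\<Sum>k<p. (norm (corner p k - b))\<^sup>2) \<le> real p"
    using sum_bounded_above[of "{..<p}" "\<lambda>k. (norm (corner p k - b))\<^sup>2" 1] by simp
  moreover have "(norm (corner p k - b))\<^sup>2 = 1 - 2 * inner (corner p k) b + (norm b)\<^sup>2" for k
    unfolding power2_norm_eq_inner inner_diff_left inner_diff_right
    using norm_corner[of p k] by (simp add: norm_eq_1 inner_commute del: norm_corner)
  moreover have "(\<Sum>k<p. inner (corner p k) b) = 0"
    using sum_corners[OF p] by (simp add: inner_sum_left[symmetric])
  ultimately have "real p * (norm b)\<^sup>2 \<le> 0"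
    by (simp add: sum.distrib sum_subtractf sum_distrib_left[symmetric])
  then show ?thesis using p unfolding b_def by (simp add: mult_le_0_iff)
qed

text \<open>Fixing the centre makes \<open>g\<close> orthogonal, hence real linear, and
  \<open>g \<i>\<close> is a unit vector perpendicular to \<open>g 1\<close>; its two possible
  positions give a complex linear and a conjugate linear map. The factor is found from the image of
  corner 0, which has norm 1 and is therefore a corner.\<close>

lemma polygon_isometry_cases:
  assumes p: "3 \<le> p" and g: "plane_isometry g" "g ` regular_polygon p = regular_polygon p"
  obtains (rotation) k where "g = (\<lambda>z. root_of_unity p ^ k * z)"
  | (reflection) u b where "g = (\<lambda>z. u * cnj z)" "u * cnj (corner p 0) = corner p b"
proof -
  have g0: "g 0 = 0" by (rule polygon_isometry_fixes_0[OF assms])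
  have orth: "orthogonal_transformation g"
    using g(1) g0 by (simp add: orthogonal_transformation_isometry plane_isometry_def)
  then have lin: "linear g" by (simp add: orthogonal_transformation_def)
  have inner: "inner (g v) (g w) = inner v w" for v w
    using orth by (simp add: orthogonal_transformation_def)
  have corner0: "\<exists>k. g (corner p 0) = corner p k"
  proof -
    have "g (corner p 0) \<in> regular_polygon p" using g(2) corner_in_polygon[of p 0] p by auto
    moreover have "norm (g (corner p 0)) = 1"
      using orth by (simp add: orthogonal_transformation_norm)
    ultimately show ?thesis using norm_1_in_polygon by blast
  qed
  define u where "u = g 1"
  define v where "v = g \<i>"
  have gz: "g z = of_real (Re z) * u + of_real (Im z) * v" for z
  proof -
    have "z = Re z *\<^sub>R 1 + Im z *\<^sub>R \<i>" by (simp add: complex_eq_iff)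
    then have "g z = g (Re z *\<^sub>R 1 + Im z *\<^sub>R \<i>)" by simp
    also have "\<dots> = Re z *\<^sub>R g 1 + Im z *\<^sub>R g \<i>"
      using lin by (simp add: linear_add linear_scale)
    finally show ?thesis by (simp add: u_def v_def scaleR_conv_of_real)
  qed
  have uu: "Re u * Re u + Im u * Im u = 1" and vv: "Re v * Re v + Im v * Im v = 1"
    and uv: "Re u * Re v + Im u * Im v = 0"
    using inner[of 1 1] inner[of \<i> \<i>] inner[of 1 \<i>] by (simp_all add: u_def v_def inner_complex_def)
  \<comment> \<open>The determinant of \<open>g\<close>.\<close>
  define l where "l = Re u * Im v - Im u * Re v"
  have "Re v = - Im u * l" using uu uv unfolding l_def by algebra
  moreover have "Im v = Re u * l" using uu uv unfolding l_def by algebra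
  ultimately have vl: "v = of_real l * (\<i> * u)" by (simp add: complex_eq_iff)
  have "Re v = - Im u * l" "Im v = Re u * l" using vl by simp_all
  then have "l * l = 1" using uu vv by algebra
  then have "l = 1 \<or> l = - 1" by (simp add: square_eq_1_iff)
  with vl consider "v = \<i> * u" | "v = - \<i> * u" by auto
  then show ?thesis
  proof cases
    case 1
    then have gu: "g z = u * z" for z
      unfolding gz by (simp add: complex_eq_iff algebra_simps)
    obtain k where "g (corner p 0) = corner p k" using corner0 by auto
    then have "u = root_of_unity p ^ k" by (simp add: gu corner_conv_power[of p k])
    then have "g = (\<lambda>z. root_of_unity p ^ k * z)" by (simp add: fun_eq_iff gu)
    then show ?thesis by (rule rotation)
  next
    case 2
    then have gu: "g z = u * cnj z" for z
      unfolding gz by (simp add: complex_eq_iff algebra_simps)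
    obtain b where "g (corner p 0) = corner p b" using corner0 by auto
    then have "u * cnj (corner p 0) = corner p b" by (simp only: gu)
    moreover have "g = (\<lambda>z. u * cnj z)" by (rule ext) (simp only: gu)
    ultimately show ?thesis using reflection by blast
  qed
qed

lemma rotation_polygon_isometry:
  assumes "0 < p"
  shows "plane_isometry ((*) (root_of_unity p ^ k))"
    and "(*) (root_of_unity p ^ k) ` regular_polygon p = regular_polygon p"
    and "orientation_preserving ((*) (root_of_unity p ^ k))"
proof -
  show "plane_isometry ((*) (root_of_unity p ^ k))"
    by (simp add: plane_isometry_def dist_norm right_diff_distrib[symmetric] norm_mult norm_power)
  show "orientation_preserving ((*) (root_of_unity p ^ k))"
    unfolding orientation_preserving_def by (rule exI[of _ "root_of_unity p ^ k"], rule exI[of _ 0]) auto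
  have "(*) (root_of_unity p ^ k) ` corner p ` {..<p} = corner p ` {..<p}"
  proof (rule endo_inj_surj)
    show "(*) (root_of_unity p ^ k) ` corner p ` {..<p} \<subseteq> corner p ` {..<p}"
    proof safe
      fix j
      have "root_of_unity p ^ k * corner p j = corner p ((j + k) mod p)"
        using assms by (simp add: corner_add[symmetric] corner_mod)
      then show "root_of_unity p ^ k * corner p j \<in> corner p ` {..<p}"
        using assms by (intro image_eqI[of _ _ "(j + k) mod p"]) auto
    qed
  qed (auto intro!: inj_onI)
  then show "(*) (root_of_unity p ^ k) ` regular_polygon p = regular_polygon p"
    unfolding regular_polygon_def
    using convex_hull_linear_image[OF linear_times, of "root_of_unity p ^ k" "corner p ` {..<p}"] by simp
qed

text \<open>Corner 0 must go to a point of norm 1, since the polygon lies in the unit disc and is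
  mapped onto itself. The criterion later decides which headings make a face a translate of a
  polygon of \<open>\<Pi>\<^sub>p\<close>.\<close>

lemma unit_polygon_eq_iff:
  assumes "3 \<le> p"
  shows "(*) u ` regular_polygon p = regular_polygon p \<longleftrightarrow> u ^ p = 1"
proof
  assume *: "(*) u ` regular_polygon p = regular_polygon p"
  have "u * corner p 0 \<in> regular_polygon p" using * corner_in_polygon[of p 0] assms by auto
  then have 1: "norm u \<le> 1" using norm_in_polygon_le by (fastforce simp: norm_mult)
  obtain x where "x \<in> regular_polygon p" "corner p 0 = u * x"
    using * corner_in_polygon[of p 0] assms by auto
  then have "1 \<le> norm u"
    using norm_in_polygon_le[of x p] norm_corner[of p 0] by (metis mult_left_le norm_ge_zero norm_mult)
  with 1 have "norm (u * corner p 0) = 1" by (simp add: norm_mult)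
  then obtain k where "u * corner p 0 = corner p k"
    using norm_1_in_polygon \<open>u * corner p 0 \<in> regular_polygon p\<close> by blast
  then have "u = root_of_unity p ^ k" by (simp add: corner_conv_power[of p k])
  then show "u ^ p = 1"
    using root_of_unity_power_power[of p] assms by simp
next
  assume "u ^ p = 1"
  then obtain k where "u = root_of_unity p ^ k" using ex_root_of_unity_power[of p u] assms by auto
  then show "(*) u ` regular_polygon p = regular_polygon p"
    using rotation_polygon_isometry(2)[of p k] assms by simp
qed

text \<open>A reflection reverses the direction of the boundary, so the parameter \<open>t\<close>
  turns into \<open>1 - t\<close>; this is how a reversed orientation is detected.\<close>

lemma reflection_side_point:
  assumes "u * cnj (corner p 0) = corner p b" "0 < p"
  shows "\<exists>j. (\<forall>t. u * cnj (side_point p k t) = side_point p j (1 - t)) \<and>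
    u * cnj (corner p k) = corner p (Suc j)"
proof -
  \<comment> \<open>Conjugation inverts \<open>\<zeta>\<close>, and \<open>p - 1\<close> is
    \<open>- 1\<close> modulo \<open>p\<close>, so corner \<open>i\<close> goes to corner
    \<open>b - i\<close>. The image side begins at the image of the end of side \<open>k\<close>,
    hence \<open>Suc k\<close>.\<close>
  define j where "j = b + (p - 1) * Suc k"
  have cnj: "cnj (root_of_unity p) * root_of_unity p = 1"
    by (metis complex_norm_square mult.commute norm_root_of_unity of_real_1 one_power2)
  have pinv: "root_of_unity p ^ (p - 1) = cnj (root_of_unity p)"
  proof -
    have "root_of_unity p ^ (p - 1) * root_of_unity p = cnj (root_of_unity p) * root_of_unity p"
      using assms(2) root_of_unity_power_gon[of p] by (simp only: cnj power_minus_mult)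
    then show ?thesis by simp
  qed
  have corner: "u * cnj (corner p i) = corner p (b + (p - 1) * i)" for i
  proof -
    have "root_of_unity p ^ ((p - 1) * i) = cnj (root_of_unity p) ^ i"
      by (simp only: power_mult pinv)
    then show ?thesis
      using assms(1) unfolding corner_conv_power[of p i] corner_add by simp
  qed
  have eq: "corner p (b + (p - 1) * k) = corner p (Suc j)"
  proof -
    have "Suc j = (b + (p - 1) * k) + p" using assms(2) by (simp add: j_def)
    then show ?thesis using assms(2) by (simp add: corner_eq_iff)
  qed
  have "u * cnj (side_point p k t) = side_point p j (1 - t)" for t
  proof -
    have "u * cnj (side_point p k t) = (1 - t) *\<^sub>R (u * cnj (corner p k)) + t *\<^sub>R (u * cnj (corner p (Suc k)))"
      by (simp add: side_point_def linepath_def algebra_simps)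
    then show ?thesis
      unfolding corner eq by (simp add: side_point_def linepath_def j_def add.commute)
  qed
  then show ?thesis using corner eq by auto
qed


section \<open>Rotations as permutations of the sides\<close>

lemma glue_relI:
  assumes "(f, k) \<in> sides D" "glue D (f, k) = (f', k')" "0 \<le> t" "t \<le> 1"
  shows "((f, side_point (gon D) k t), (f', side_point (gon D) k' (1 - t))) \<in> glue_rel D"
  unfolding glue_rel_def side_point_reverse using assms by (force simp: side_point_def)

lemma glue_relE:
  assumes "(a, b) \<in> glue_rel D"
  obtains f k f' k' t where "(f, k) \<in> sides D" "glue D (f, k) = (f', k')" "0 \<le> t" "t \<le> 1"
    "a = (f, side_point (gon D) k t)" "b = (f', side_point (gon D) k' (1 - t))"
  using assms unfolding glue_rel_def side_point_reverse
  by (auto simp: side_point_def[symmetric]) metis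

lemma pt_refl: "a \<in> pt D a"
  by (simp add: pt_def)

lemma pt_subset:
  assumes "a \<in> S" "\<And>b c. b \<in> S \<Longrightarrow> (b, c) \<in> glue_rel D \<Longrightarrow> c \<in> S"
  shows "pt D a \<subseteq> S"
proof
  fix b assume "b \<in> pt D a"
  then have "(a, b) \<in> (glue_rel D)\<^sup>*" by (simp add: pt_def)
  then show "b \<in> S" by induction (use assms in auto)
qed

text \<open>Every side keeps distance at least 1/2 from the centre, so nothing is glued there.
  Singleton classes allow a map of points to be read off in the charts.\<close>

lemma pt_interior:
  assumes "3 \<le> gon D" "norm z < 1 / 2"
  shows "pt D (f, z) = {(f, z)}"
proof
  show "pt D (f, z) \<subseteq> {(f, z)}"
  proof (rule pt_subset)
    fix b c assume "b \<in> {(f, z)}" "(b, c) \<in> glue_rel D"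
    then have "\<exists>k t. z = side_point (gon D) k t" by (auto elim!: glue_relE)
    then show "c \<in> {(f, z)}" using norm_side_point_ge[OF assms(1)] assms(2) by (metis not_less)
  qed simp
qed (simp add: pt_refl)

text \<open>A point with singleton class off the centre: unlike the centre, it reveals the angle by
  which a map turns the face.\<close>

definition interior_point :: "nat \<Rightarrow> complex" where
  "interior_point p = corner p 0 / 4"

lemma interior_point:
  assumes "3 \<le> p"
  shows "interior_point p \<in> regular_polygon p" "norm (interior_point p) < 1 / 2" "interior_point p \<noteq> 0"
proof -
  have "(3 / 4) *\<^sub>R 0 + (1 / 4) *\<^sub>R corner p 0 \<in> regular_polygon p"
    using assms by (intro convexD convex_regular_polygon zero_in_polygon corner_in_polygon) auto
  then show "interior_point p \<in> regular_polygon p"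
    by (simp add: interior_point_def scaleR_conv_of_real)
qed (simp_all add: interior_point_def norm_divide)

section \<open>Parallel transport along galleries\<close>

lemma gallery_append:
  "gallery D f (xs @ ys) g \<longleftrightarrow> (\<exists>m. gallery D f xs m \<and> gallery D m ys g)"
proof (induction xs arbitrary: f)
  case Nil
  show ?case by (cases ys) (auto simp: sides_def)
qed auto

lemma transport_append: "transport D (xs @ ys) = transport D xs * transport D ys"
  by (simp add: transport_def)

text \<open>The transports between two faces without the lists that realise them;
  \<open>parallel D f t f\<close> says that \<open>t\<close> lies in the holonomy group at
  \<open>f\<close>.\<close>

definition parallel :: "'f poly_surface \<Rightarrow> 'f \<Rightarrow> complex \<Rightarrow> 'f \<Rightarrow> bool" where
  "parallel D f t g \<longleftrightarrow> (\<exists>ss. gallery D f ss g \<and> transport D ss = t)"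

lemma parallel_refl: "f \<in> faces D \<Longrightarrow> parallel D f 1 f"
  unfolding parallel_def by (rule exI[of _ "[]"]) (simp add: transport_def)

lemma parallel_trans: "parallel D f t g \<Longrightarrow> parallel D g u h \<Longrightarrow> parallel D f (t * u) h"
  unfolding parallel_def by (metis gallery_append transport_append)

section \<open>Combinatorial symmetries\<close>

definition rot_side :: "'f poly_surface \<Rightarrow> ('f \<Rightarrow> 'f) \<Rightarrow> ('f \<Rightarrow> nat) \<Rightarrow> 'f \<times> nat \<Rightarrow> 'f \<times> nat" where
  "rot_side D \<sigma> a = (\<lambda>(f, k). (\<sigma> f, (k + a f) mod gon D))"

definition rot_chart :: "'f poly_surface \<Rightarrow> ('f \<Rightarrow> 'f) \<Rightarrow> ('f \<Rightarrow> nat) \<Rightarrow> 'f \<times> complex \<Rightarrow> 'f \<times> complex" where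
  "rot_chart D \<sigma> a = (\<lambda>(f, z). (\<sigma> f, root_of_unity (gon D) ^ a f * z))"

text \<open>Only \<open>a f\<close> modulo \<open>p\<close> matters. That \<open>\<sigma>\<close>
  permutes the faces follows from connectedness and finiteness, see
  \<open>symmetry_bij\<close>.\<close>

definition symmetry :: "'f poly_surface \<Rightarrow> ('f \<Rightarrow> 'f) \<Rightarrow> ('f \<Rightarrow> nat) \<Rightarrow> bool" where
  "symmetry D \<sigma> a \<longleftrightarrow> \<sigma> ` faces D \<subseteq> faces D \<and>
     (\<forall>s\<in>sides D. glue D (rot_side D \<sigma> a s) = rot_side D \<sigma> a (glue D s))"

definition rot_map :: "'f poly_surface \<Rightarrow> ('f \<Rightarrow> 'f) \<Rightarrow> ('f \<Rightarrow> nat) \<Rightarrow>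
    ('f \<times> complex) set \<Rightarrow> ('f \<times> complex) set" where
  "rot_map D \<sigma> a = restrict ((`) (rot_chart D \<sigma> a)) (points D)"

locale surface =
  fixes D :: "'f poly_surface"
  assumes polygonal: "polygonal_surface D"
begin

abbreviation p :: nat where "p \<equiv> gon D"
abbreviation \<zeta> :: complex where "\<zeta> \<equiv> root_of_unity (gon D)"

lemma gon_ge: "3 \<le> p"
  using polygonal by (simp add: polygonal_surface_def)

lemma gon_pos [simp]: "0 < p"
  using gon_ge by simp

lemma finite_sides: "finite (sides D)"
  using polygonal by (simp add: polygonal_surface_def sides_def)

lemma glue_in_sides: "s \<in> sides D \<Longrightarrow> glue D s \<in> sides D"
  and glue_neq: "s \<in> sides D \<Longrightarrow> glue D s \<noteq> s"
  and glue_glue: "s \<in> sides D \<Longrightarrow> glue D (glue D s) = s"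
  using polygonal by (auto simp: polygonal_surface_def)

lemma fst_glue_in_faces: "s \<in> sides D \<Longrightarrow> fst (glue D s) \<in> faces D"
  using glue_in_sides[of s] by (auto simp: sides_def)

lemma gallery_in_faces: "gallery D f ss g \<Longrightarrow> f \<in> faces D \<and> g \<in> faces D"
  by (induction ss arbitrary: f) (auto simp: sides_def)

lemma parallel_in_faces: "parallel D f t g \<Longrightarrow> f \<in> faces D \<and> g \<in> faces D"
  using gallery_in_faces by (auto simp: parallel_def)

lemma parallel_step:
  assumes "s \<in> sides D"
  shows "parallel D (fst s) (turn D s) (fst (glue D s))"
  unfolding parallel_def
  using assms fst_glue_in_faces[OF assms] by (intro exI[of _ "[s]"]) (simp add: transport_def)

lemma turn_conv: "turn D s = - (\<zeta> ^ snd (glue D s) / \<zeta> ^ snd s)"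
  using edge_vec_nonzero[OF gon_ge, of 0]
  unfolding turn_def edge_vec_conv_power[of p "snd (glue D s)"] edge_vec_conv_power[of p "snd s"]
  by simp

lemma turn_glue: "s \<in> sides D \<Longrightarrow> turn D (glue D s) = 1 / turn D s"
  by (simp add: turn_conv glue_glue)

lemma turn_nonzero: "turn D s \<noteq> 0"
  by (simp add: turn_conv)

lemma parallel_connected: "f \<in> faces D \<Longrightarrow> g \<in> faces D \<Longrightarrow> \<exists>t. parallel D f t g"
  using polygonal by (auto simp: polygonal_surface_def parallel_def)

text \<open>The gallery is extended at its far end, so that the base face \<open>f\<close> stays
  fixed.\<close>

lemma parallel_induct [consumes 1, case_names refl step]:
  assumes "parallel D f t g"
    and "P 1 f"
    and "\<And>t s. parallel D f t (fst s) \<Longrightarrow> P t (fst s) \<Longrightarrow> s \<in> sides D \<Longrightarrow>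
      P (t * turn D s) (fst (glue D s))"
  shows "P t g"
proof -
  obtain ss where "gallery D f ss g" "transport D ss = t"
    using assms(1) by (auto simp: parallel_def)
  then show ?thesis
  proof (induction ss arbitrary: t g rule: rev_induct)
    case Nil
    then show ?case using assms(2) by (auto simp: transport_def)
  next
    case (snoc s ss)
    then have ss: "gallery D f ss (fst s)" and s: "s \<in> sides D" "fst (glue D s) = g"
      by (auto simp: gallery_append)
    have t: "t = transport D ss * turn D s"
      using snoc.prems by (simp add: transport_append) (simp add: transport_def)
    have "parallel D f (transport D ss) (fst s)" using ss by (auto simp: parallel_def)
    then show ?case using assms(3)[OF _ snoc.IH[OF ss refl] s(1)] s(2) t by simp
  qed
qed

lemma parallel_nonzero: "parallel D f t g \<Longrightarrow> t \<noteq> 0"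
  by (induction rule: parallel_induct) (auto simp: turn_nonzero)

lemma parallel_sym:
  assumes "parallel D f t g"
  shows "parallel D g (1 / t) f"
  using assms
proof (induction rule: parallel_induct)
  case refl
  show ?case using parallel_in_faces[OF assms] parallel_refl[of f D] by simp
next
  case (step t s)
  have "parallel D (fst (glue D s)) (turn D (glue D s)) (fst (glue D (glue D s)))"
    by (rule parallel_step[OF glue_in_sides[OF step.hyps(2)]])
  then have "parallel D (fst (glue D s)) (1 / turn D s) (fst s)"
    by (simp add: glue_glue turn_glue step)
  from parallel_trans[OF this step.IH] show ?case by (simp add: mult.commute)
qed

lemma parallel_value: "parallel D f t g \<Longrightarrow> \<exists>i j. t = (- 1) ^ i * \<zeta> ^ j"
proof (induction rule: parallel_induct)
  case refl
  show ?case by (intro exI[of _ 0]) simp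
next
  case (step t s)
  then obtain i j where t: "t = (- 1) ^ i * \<zeta> ^ j" by blast
  \<comment> \<open>The inverse of a power of \<open>\<zeta>\<close> is again such a power, which
    keeps the exponents natural numbers.\<close>
  have "(1 / \<zeta> ^ snd s) ^ p = 1"
    unfolding power_one_over root_of_unity_power_power[OF gon_pos] by simp
  from ex_root_of_unity_power[OF gon_pos this] obtain l where l: "1 / \<zeta> ^ snd s = \<zeta> ^ l"
    by blast
  have "turn D s = - (\<zeta> ^ snd (glue D s) * (1 / \<zeta> ^ snd s))" by (simp add: turn_conv)
  then have "t * turn D s = (- 1) ^ Suc i * \<zeta> ^ (j + snd (glue D s) + l)"
    unfolding l t by (simp add: power_add)
  then show ?case by blast
qed

lemma symmetry_faces: "symmetry D \<sigma> a \<Longrightarrow> f \<in> faces D \<Longrightarrow> \<sigma> f \<in> faces D"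
  by (auto simp: symmetry_def)

lemma symmetry_glue:
  "symmetry D \<sigma> a \<Longrightarrow> s \<in> sides D \<Longrightarrow> glue D (rot_side D \<sigma> a s) = rot_side D \<sigma> a (glue D s)"
  by (auto simp: symmetry_def)

lemma rot_side_in_sides: "symmetry D \<sigma> a \<Longrightarrow> s \<in> sides D \<Longrightarrow> rot_side D \<sigma> a s \<in> sides D"
  by (auto simp: sides_def rot_side_def symmetry_faces)

text \<open>The shifts turn the charts on the two sides of the edge by their own angles. These
  corrections telescope along a gallery, so that in \<open>parallel_symmetry\<close> only those of
  the two end faces survive.\<close>

lemma turn_rot_side:
  assumes "symmetry D \<sigma> a" "s \<in> sides D"
  shows "turn D (rot_side D \<sigma> a s) = turn D s * \<zeta> ^ a (fst (glue D s)) / \<zeta> ^ a (fst s)"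
  unfolding turn_conv symmetry_glue[OF assms]
  by (simp add: rot_side_def case_prod_beta root_of_unity_power_mod power_add)

lemma parallel_symmetry:
  assumes "symmetry D \<sigma> a" "parallel D f t g"
  shows "parallel D (\<sigma> f) (t * \<zeta> ^ a g / \<zeta> ^ a f) (\<sigma> g)"
  using assms(2)
proof (induction rule: parallel_induct)
  case refl
  show ?case using parallel_in_faces[OF assms(2)] symmetry_faces[OF assms(1)] parallel_refl[of "\<sigma> f" D] by simp
next
  case (step t s)
  have "parallel D (\<sigma> (fst s)) (turn D (rot_side D \<sigma> a s)) (\<sigma> (fst (glue D s)))"
    using parallel_step[OF rot_side_in_sides[OF assms(1) step.hyps(2)]]
    unfolding symmetry_glue[OF assms(1) step.hyps(2)] by (simp add: rot_side_def case_prod_beta)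
  from parallel_trans[OF step.IH this] show ?case
    by (simp add: turn_rot_side[OF assms(1) step.hyps(2)] mult_ac)
qed

section \<open>Symmetries as maps of points\<close>

lemma sym_glue_rel: "(a, b) \<in> glue_rel D \<Longrightarrow> (b, a) \<in> glue_rel D"
proof (erule glue_relE)
  fix f k f' k' t
  assume *: "(f, k) \<in> sides D" "glue D (f, k) = (f', k')" "0 \<le> (t::real)" "t \<le> 1"
    "a = (f, side_point p k t)" "b = (f', side_point p k' (1 - t))"
  show "(b, a) \<in> glue_rel D"
    using glue_relI[of f' k' D f k "1 - t"] glue_in_sides[OF *(1)] glue_glue[OF *(1)] * by simp
qed

lemma pt_eqI: "b \<in> pt D a \<Longrightarrow> pt D b = pt D a"
proof -
  assume "b \<in> pt D a"
  then have ab: "(a, b) \<in> (glue_rel D)\<^sup>*" by (simp add: pt_def)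
  have "sym (glue_rel D)" using sym_glue_rel by (auto intro: symI)
  then have "(b, a) \<in> (glue_rel D)\<^sup>*" using ab by (metis symD sym_rtrancl)
  with ab show ?thesis unfolding pt_def by (auto intro: rtrancl_trans)
qed

lemma pt_glue: "(a, b) \<in> glue_rel D \<Longrightarrow> pt D a = pt D b"
  using pt_eqI[of b a] by (auto simp: pt_def)

text \<open>An inner point of a side lies on no other side of its polygon, and the pairing is an
  involution, so the class closes up after one gluing. Corners behave differently and are treated
  with \<open>vertex_step\<close>.\<close>

lemma pt_side_point:
  assumes s: "(f, k) \<in> sides D" "glue D (f, k) = (f', k')" and t: "0 < t" "t < 1"
  shows "pt D (f, side_point p k t) = {(f, side_point p k t), (f', side_point p k' (1 - t))}"
    (is "_ = ?S")
proof
  have s': "(f', k') \<in> sides D" "glue D (f', k') = (f, k)"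
    using glue_in_sides[OF s(1)] glue_glue[OF s(1)] s(2) by auto
  show "pt D (f, side_point p k t) \<subseteq> ?S"
  proof (rule pt_subset)
    fix b c assume b: "b \<in> ?S" and "(b, c) \<in> glue_rel D"
    from this(2) obtain g j g' j' u where *: "(g, j) \<in> sides D" "glue D (g, j) = (g', j')"
      "b = (g, side_point p j u)" "c = (g', side_point p j' (1 - u))"
      by (rule glue_relE)
    have j: "j < p" "k < p" "k' < p" using s s' * by (auto simp: sides_def)
    from b consider "b = (f, side_point p k t)" | "b = (f', side_point p k' (1 - t))" by auto
    then show "c \<in> ?S"
    proof cases
      case 1
      then have "g = f" "side_point p j u = side_point p k t" using * by auto
      with side_point_eqD[OF gon_ge t this(2)] j have "u = t" "j = k" by auto
      then show ?thesis using * s \<open>g = f\<close> by auto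
    next
      case 2
      then have "g = f'" "side_point p j u = side_point p k' (1 - t)" using * by auto
      with side_point_eqD[OF gon_ge _ _ this(2)] j t have "u = 1 - t" "j = k'" by auto
      then show ?thesis using * s' \<open>g = f'\<close> by auto
    qed
  qed simp
  show "?S \<subseteq> pt D (f, side_point p k t)"
    using glue_relI[OF s, of t] t by (auto simp: pt_def)
qed

lemma pt_in_faces:
  assumes "f \<in> faces D"
  shows "pt D (f, z) \<subseteq> faces D \<times> UNIV"
proof (rule pt_subset)
  fix b c assume "(b, c) \<in> glue_rel D"
  then show "c \<in> faces D \<times> UNIV" by (rule glue_relE) (use fst_glue_in_faces in force)
qed (use assms in auto)

lemma pt_in_points: "f \<in> faces D \<Longrightarrow> z \<in> regular_polygon p \<Longrightarrow> pt D (f, z) \<in> points D"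
  by (auto simp: points_def)

lemma pointsE:
  assumes "X \<in> points D"
  obtains f z where "f \<in> faces D" "z \<in> regular_polygon p" "X = pt D (f, z)"
  using assms by (auto simp: points_def)

lemma rot_chart_side_point:
  "rot_chart D \<sigma> a (f, side_point p k t) = (\<sigma> f, side_point p ((k + a f) mod p) t)"
  by (simp add: rot_chart_def side_point_mod side_point_add)

lemma ex_shift_mod:
  assumes "j < p"
  shows "\<exists>k<p. (k + i) mod p = j"
proof -
  have "((j + (p - i mod p)) mod p + i) mod p = (j + (p - i mod p) + i mod p) mod p"
    by (simp add: mod_simps)
  also have "j + (p - i mod p) + i mod p = j + p"
    using mod_less_divisor[OF gon_pos, of i] by linarith
  also have "(j + p) mod p = j" using assms by simp
  finally show ?thesis by (intro exI[of _ "(j + (p - i mod p)) mod p"]) simp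
qed

text \<open>The second part lifts a gluing back through the chart map; together the two parts show
  that the image of a class is a whole class.\<close>

lemma glue_rel_rot_chart:
  assumes "symmetry D \<sigma> a"
  shows "(b, c) \<in> glue_rel D \<Longrightarrow> (rot_chart D \<sigma> a b, rot_chart D \<sigma> a c) \<in> glue_rel D"
    and "b \<in> faces D \<times> UNIV \<Longrightarrow> (rot_chart D \<sigma> a b, e) \<in> glue_rel D \<Longrightarrow>
      \<exists>c. (b, c) \<in> glue_rel D \<and> e = rot_chart D \<sigma> a c"
proof -
  assume "(b, c) \<in> glue_rel D"
  then obtain f k f' k' t where *: "(f, k) \<in> sides D" "glue D (f, k) = (f', k')" "0 \<le> (t::real)" "t \<le> 1"
    "b = (f, side_point p k t)" "c = (f', side_point p k' (1 - t))"
    by (rule glue_relE)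
  have "glue D (rot_side D \<sigma> a (f, k)) = rot_side D \<sigma> a (f', k')"
    using symmetry_glue[OF assms *(1)] *(2) by simp
  then show "(rot_chart D \<sigma> a b, rot_chart D \<sigma> a c) \<in> glue_rel D"
    unfolding *(5,6) rot_chart_side_point
    using glue_relI[of _ _ D _ _ t] rot_side_in_sides[OF assms *(1)] * by (simp add: rot_side_def)
next
  assume b: "b \<in> faces D \<times> UNIV" and "(rot_chart D \<sigma> a b, e) \<in> glue_rel D"
  then obtain g j g' j' t where *: "(g, j) \<in> sides D" "glue D (g, j) = (g', j')" "0 \<le> (t::real)" "t \<le> 1"
    "rot_chart D \<sigma> a b = (g, side_point p j t)" "e = (g', side_point p j' (1 - t))"
    by (auto elim: glue_relE)
  obtain f z where bf: "b = (f, z)" "f \<in> faces D" using b by auto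
  obtain k where k: "k < p" "(k + a f) mod p = j"
    using ex_shift_mod[of j "a f"] *(1) by (auto simp: sides_def)
  have g: "g = \<sigma> f" using *(5) bf by (simp add: rot_chart_def)
  have "rot_chart D \<sigma> a (f, side_point p k t) = rot_chart D \<sigma> a (f, z)"
    using *(5) k g bf by (simp add: rot_chart_side_point)
  then have z: "z = side_point p k t" by (simp add: rot_chart_def)
  have fk: "(f, k) \<in> sides D" using bf k by (simp add: sides_def)
  obtain f' k' where gl: "glue D (f, k) = (f', k')" by fastforce
  have "(g', j') = rot_side D \<sigma> a (f', k')"
    using symmetry_glue[OF assms fk] gl k g *(2) by (simp add: rot_side_def)
  then have "e = rot_chart D \<sigma> a (f', side_point p k' (1 - t))"
    unfolding *(6) rot_chart_side_point by (simp add: rot_side_def)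
  moreover have "(b, (f', side_point p k' (1 - t))) \<in> glue_rel D"
    using glue_relI[OF fk gl *(3,4)] bf z by simp
  ultimately show "\<exists>c. (b, c) \<in> glue_rel D \<and> e = rot_chart D \<sigma> a c" by blast
qed

lemma rot_chart_image_pt:
  assumes "symmetry D \<sigma> a" "f \<in> faces D"
  shows "rot_chart D \<sigma> a ` pt D (f, z) = pt D (\<sigma> f, \<zeta> ^ a f * z)"
proof
  show "rot_chart D \<sigma> a ` pt D (f, z) \<subseteq> pt D (\<sigma> f, \<zeta> ^ a f * z)"
  proof -
    have "pt D (f, z) \<subseteq> {b. rot_chart D \<sigma> a b \<in> pt D (\<sigma> f, \<zeta> ^ a f * z)}"
    proof (rule pt_subset)
      fix b c assume "b \<in> {b. rot_chart D \<sigma> a b \<in> pt D (\<sigma> f, \<zeta> ^ a f * z)}" "(b, c) \<in> glue_rel D"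
      then show "c \<in> {b. rot_chart D \<sigma> a b \<in> pt D (\<sigma> f, \<zeta> ^ a f * z)}"
        using glue_rel_rot_chart(1)[OF assms(1), of b c] by (auto simp: pt_def intro: rtrancl_into_rtrancl)
    qed (simp add: rot_chart_def pt_refl)
    then show ?thesis by auto
  qed
  show "pt D (\<sigma> f, \<zeta> ^ a f * z) \<subseteq> rot_chart D \<sigma> a ` pt D (f, z)"
  proof (rule pt_subset)
    show "(\<sigma> f, \<zeta> ^ a f * z) \<in> rot_chart D \<sigma> a ` pt D (f, z)"
      using pt_refl[of "(f, z)" D] by (force simp: rot_chart_def)
    fix b c assume "b \<in> rot_chart D \<sigma> a ` pt D (f, z)" and bc: "(b, c) \<in> glue_rel D"
    then obtain b' where b': "b' \<in> pt D (f, z)" "b = rot_chart D \<sigma> a b'" by auto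
    then have "b' \<in> faces D \<times> UNIV" using pt_in_faces[OF assms(2)] by blast
    then obtain c' where "(b', c') \<in> glue_rel D" "c = rot_chart D \<sigma> a c'"
      using glue_rel_rot_chart(2)[OF assms(1), of b' c] bc b' by auto
    then show "c \<in> rot_chart D \<sigma> a ` pt D (f, z)"
      using b' by (auto simp: pt_def intro: rtrancl_into_rtrancl)
  qed
qed

lemma rot_map_pt:
  assumes "symmetry D \<sigma> a" "f \<in> faces D" "z \<in> regular_polygon p"
  shows "rot_map D \<sigma> a (pt D (f, z)) = pt D (\<sigma> f, \<zeta> ^ a f * z)"
  using pt_in_points[OF assms(2,3)] rot_chart_image_pt[OF assms(1,2)] by (simp add: rot_map_def)

text \<open>Since a shift reaches every side of an image face, the set of image faces is closed
  under crossing sides. Connectedness gives surjectivity, and finiteness then injectivity.\<close>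

lemma symmetry_bij:
  assumes "symmetry D \<sigma> a"
  shows "bij_betw \<sigma> (faces D) (faces D)"
proof -
  have fin: "finite (faces D)" and ne: "faces D \<noteq> {}"
    using polygonal by (auto simp: polygonal_surface_def)
  obtain f where f: "f \<in> faces D" using ne by blast
  have "g \<in> \<sigma> ` faces D" if "g \<in> faces D" for g
  proof -
    from parallel_connected[OF symmetry_faces[OF assms f] that]
    obtain t where "parallel D (\<sigma> f) t g" ..
    then show ?thesis
    proof (induction rule: parallel_induct)
      case (step t s)
      then obtain e where e: "e \<in> faces D" "fst s = \<sigma> e" by auto
      obtain k where k: "k < p" "(k + a e) mod p = snd s"
        using ex_shift_mod[of "snd s" "a e"] step.hyps(2) by (auto simp: sides_def)
      have ek: "(e, k) \<in> sides D" using e k by (simp add: sides_def)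
      have "s = rot_side D \<sigma> a (e, k)" using e k by (simp add: rot_side_def prod_eq_iff)
      then have "fst (glue D s) = \<sigma> (fst (glue D (e, k)))"
        using symmetry_glue[OF assms ek] by (simp add: rot_side_def case_prod_beta)
      then show ?case using fst_glue_in_faces[OF ek] by auto
    qed (use f in auto)
  qed
  then have "\<sigma> ` faces D = faces D" using assms by (auto simp: symmetry_def)
  then show ?thesis using fin by (simp add: bij_betw_def eq_card_imp_inj_on)
qed

lemma rot_map_Bij:
  assumes "symmetry D \<sigma> a"
  shows "rot_map D \<sigma> a \<in> Bij (points D)"
proof -
  have bij: "bij_betw \<sigma> (faces D) (faces D)" by (rule symmetry_bij[OF assms])
  have inj: "inj_on (rot_chart D \<sigma> a) (faces D \<times> UNIV)"
  proof (rule inj_onI, clarify)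
    fix f z g w assume *: "f \<in> faces D" "g \<in> faces D" "rot_chart D \<sigma> a (f, z) = rot_chart D \<sigma> a (g, w)"
    then have "f = g" using bij by (auto simp: rot_chart_def bij_betw_def inj_on_def)
    then show "f = g \<and> z = w" using * by (simp add: rot_chart_def)
  qed
  have sub: "X \<subseteq> faces D \<times> UNIV" if "X \<in> points D" for X
    using that pt_in_faces by (auto elim!: pointsE)
  have "inj_on (rot_map D \<sigma> a) (points D)"
    by (rule inj_onI) (use inj_on_image_eq_iff[OF inj sub sub] in \<open>auto simp: rot_map_def\<close>)
  moreover have "rot_map D \<sigma> a ` points D = points D"
  proof safe
    fix X assume "X \<in> points D"
    then obtain f z where X: "f \<in> faces D" "z \<in> regular_polygon p" "X = pt D (f, z)" by (rule pointsE)
    have "\<zeta> ^ a f * z \<in> regular_polygon p"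
      using rotation_polygon_isometry(2)[OF gon_pos, of "a f"] X(2) by blast
    then show "rot_map D \<sigma> a X \<in> points D"
      using X rot_map_pt[OF assms X(1,2)] pt_in_points symmetry_faces[OF assms] by simp
  next
    fix X assume "X \<in> points D"
    then obtain g w where X: "g \<in> faces D" "w \<in> regular_polygon p" "X = pt D (g, w)" by (rule pointsE)
    then obtain f where f: "f \<in> faces D" "g = \<sigma> f" using bij by (auto simp: bij_betw_def)
    obtain z where "z \<in> regular_polygon p" "w = \<zeta> ^ a f * z"
      using rotation_polygon_isometry(2)[OF gon_pos, of "a f"] X(2) by blast
    then show "X \<in> rot_map D \<sigma> a ` points D"
      using X f rot_map_pt[OF assms f(1)] pt_in_points by (intro image_eqI[of _ _ "pt D (f, z)"]) auto
  qed
  ultimately show ?thesis by (simp add: Bij_def bij_betw_def rot_map_def)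
qed

lemma rot_map_carries_face:
  assumes "symmetry D \<sigma> a" "f \<in> faces D"
  shows "carries_face D (rot_map D \<sigma> a) f (\<sigma> f) ((*) (\<zeta> ^ a f))"
  using rotation_polygon_isometry(1,2)[OF gon_pos, of "a f"] symmetry_faces[OF assms] rot_map_pt[OF assms]
  by (simp add: carries_face_def)

lemma rot_map_in_Rot:
  assumes "symmetry D \<sigma> a"
  shows "rot_map D \<sigma> a \<in> carrier (Rot D)"
  unfolding Rot_def automorphisms_def
  using rot_map_Bij[OF assms] rot_map_carries_face[OF assms] rotation_polygon_isometry(3)[OF gon_pos]
  by auto

text \<open>Rigidity: agreement on one face passes across each of its sides, because both symmetries
  commute with the pairing.\<close>

lemma symmetry_eq_faces:
  assumes "symmetry D \<sigma> a" "symmetry D \<tau> b" "f \<in> faces D" "\<sigma> f = \<tau> f" "\<zeta> ^ a f = \<zeta> ^ b f"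
    and "g \<in> faces D"
  shows "\<sigma> g = \<tau> g \<and> \<zeta> ^ a g = \<zeta> ^ b g"
proof -
  obtain t where "parallel D f t g" using parallel_connected assms by blast
  then show ?thesis
  proof (induction rule: parallel_induct)
    case (step t s)
    then have "(snd s + a (fst s)) mod p = (snd s + b (fst s)) mod p"
      by (metis gon_pos mod_add_right_eq root_of_unity_power_eq_iff)
    then have "rot_side D \<sigma> a s = rot_side D \<tau> b s"
      using step by (simp add: rot_side_def case_prod_beta)
    then have "rot_side D \<sigma> a (glue D s) = rot_side D \<tau> b (glue D s)"
      using symmetry_glue[OF assms(1) step.hyps(2)] symmetry_glue[OF assms(2) step.hyps(2)] by simp
    moreover obtain g k where "glue D s = (g, k)" by fastforce
    ultimately have "\<sigma> g = \<tau> g" "\<zeta> ^ (k + a g) = \<zeta> ^ (k + b g)" "g = fst (glue D s)"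
      by (auto simp: rot_side_def root_of_unity_power_eq_iff)
    then show ?case by (simp add: power_add)
  qed (use assms in auto)
qed

lemma rot_map_eqI:
  assumes "symmetry D \<sigma> a" "symmetry D \<tau> b" "f \<in> faces D" "\<sigma> f = \<tau> f" "\<zeta> ^ a f = \<zeta> ^ b f"
  shows "rot_map D \<sigma> a = rot_map D \<tau> b"
proof
  fix X
  show "rot_map D \<sigma> a X = rot_map D \<tau> b X"
  proof (cases "X \<in> points D")
    case True
    then obtain g z where X: "g \<in> faces D" "z \<in> regular_polygon p" "X = pt D (g, z)" by (rule pointsE)
    then show ?thesis
      using symmetry_eq_faces[OF assms X(1)] rot_map_pt[OF assms(1) X(1,2)] rot_map_pt[OF assms(2) X(1,2)]
      by simp
  qed (simp add: rot_map_def)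
qed

lemma symmetry_comp:
  assumes "symmetry D \<sigma> a" "symmetry D \<tau> b"
  shows "symmetry D (\<lambda>f. \<tau> (\<sigma> f)) (\<lambda>f. a f + b (\<sigma> f))"
proof -
  have *: "rot_side D (\<lambda>f. \<tau> (\<sigma> f)) (\<lambda>f. a f + b (\<sigma> f)) s = rot_side D \<tau> b (rot_side D \<sigma> a s)" for s
    by (simp add: rot_side_def case_prod_beta mod_simps add.assoc)
  show ?thesis
    using symmetry_glue[OF assms(1)] symmetry_glue[OF assms(2)] rot_side_in_sides[OF assms(1)]
      symmetry_faces[OF assms(1)] symmetry_faces[OF assms(2)]
    by (auto simp: symmetry_def *)
qed

text \<open>The right factor acts first, so the shift of the left factor is taken at the image face
  \<open>\<sigma> f\<close>.\<close>

lemma Rot_mult: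
  assumes "symmetry D \<sigma> a" "symmetry D \<tau> b"
  shows "rot_map D \<tau> b \<otimes>\<^bsub>Rot D\<^esub> rot_map D \<sigma> a = rot_map D (\<lambda>f. \<tau> (\<sigma> f)) (\<lambda>f. a f + b (\<sigma> f))"
proof -
  have "rot_map D \<tau> b \<otimes>\<^bsub>Rot D\<^esub> rot_map D \<sigma> a = compose (points D) (rot_map D \<tau> b) (rot_map D \<sigma> a)"
    using rot_map_Bij[OF assms(1)] rot_map_Bij[OF assms(2)] by (simp add: Rot_def BijGroup_def)
  also have "\<dots> = rot_map D (\<lambda>f. \<tau> (\<sigma> f)) (\<lambda>f. a f + b (\<sigma> f))"
  proof
    fix X
    show "compose (points D) (rot_map D \<tau> b) (rot_map D \<sigma> a) X =
        rot_map D (\<lambda>f. \<tau> (\<sigma> f)) (\<lambda>f. a f + b (\<sigma> f)) X"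
    proof (cases "X \<in> points D")
      case True
      then have "rot_map D \<sigma> a X \<in> points D"
        using rot_map_Bij[OF assms(1)] by (auto simp: Bij_def bij_betw_def)
      then show ?thesis
        using True by (auto simp: compose_def rot_map_def image_image rot_chart_def case_prod_beta power_add mult_ac)
    qed (simp add: compose_def rot_map_def)
  qed
  finally show ?thesis .
qed

end


section \<open>Automorphisms and holonomy around a vertex\<close>

text \<open>By injectivity the first value to recur is \<open>s\<close> itself, so the number of
  distinct iterates is the least return time. Applied to \<open>vertex_step\<close>, it turns the
  degree of a vertex into the length of a closed walk.\<close>

lemma funpow_orbit_card:
  assumes "finite S" "s \<in> S" "f ` S \<subseteq> S" "inj_on f S"
  shows "(f ^^ card (range (\<lambda>n. (f ^^ n) s))) s = s"
proof -
  define g where "g n = (f ^^ n) s" for n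
  have gS: "g n \<in> S" for n by (induction n) (use assms in \<open>auto simp: g_def\<close>)
  have cancel: "g (m + k) = g (n + k) \<Longrightarrow> g m = g n" for m n k
  proof (induction k)
    case (Suc k)
    then have "f (g (m + k)) = f (g (n + k))" by (simp add: g_def)
    then have "g (m + k) = g (n + k)" using assms(4) gS by (auto dest: inj_onD)
    then show ?case by (rule Suc.IH)
  qed simp
  have "\<not> inj g"
  proof
    assume "inj g"
    then have "infinite (range g)" using finite_imageD infinite_UNIV_nat by blast
    moreover have "finite (range g)" using gS assms(1) by (meson finite_subset image_subsetI)
    ultimately show False by simp
  qed
  then obtain m n where "g m = g n" "m < n"
    by (metis injI linorder_neqE_nat)
  then have "g (n - m) = g 0" using cancel[of "n - m" m 0] by simp
  then have ex: "\<exists>k>0. g k = s" using \<open>m < n\<close> by (intro exI[of _ "n - m"]) (simp add: g_def)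
  define k where "k = (LEAST k. 0 < k \<and> g k = s)"
  have k: "0 < k" "g k = s" and least: "\<And>j. 0 < j \<Longrightarrow> g j = s \<Longrightarrow> k \<le> j"
    using LeastI_ex[OF ex] Least_le[of "\<lambda>k. 0 < k \<and> g k = s"] unfolding k_def by auto
  have gk: "g (n + k) = g n" for n using k by (simp add: g_def funpow_add)
  have inj: "inj_on g {..<k}"
  proof (rule linorder_inj_onI)
    fix i j assume ij: "i < j" "i \<in> {..<k}" "j \<in> {..<k}"
    show "g i \<noteq> g j"
    proof
      assume "g i = g j"
      then have "g (j - i) = g 0" using cancel[of "j - i" i 0] ij by simp
      then have "k \<le> j - i" using ij by (intro least) (auto simp: g_def)
      then show False using ij by simp
    qed
  qed auto
  have "g n \<in> g ` {..<k}" for n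
  proof (induction n rule: less_induct)
    case (less n)
    show ?case
    proof (cases "n < k")
      case False
      then have "g n = g (n - k)" using gk[of "n - k"] by simp
      then show ?thesis using less[of "n - k"] False k by simp
    qed auto
  qed
  then have "range g = g ` {..<k}" by auto
  then have "card (range g) = k" using card_image[OF inj] by simp
  then show ?thesis using k by (simp add: g_def[abs_def])
qed

text \<open>Side \<open>k - 1\<close> ends at corner \<open>k\<close>; across it lies the side of
  the neighbour that starts at the same vertex. Iteration walks counterclockwise around that
  vertex.\<close>

definition vertex_step :: "'f poly_surface \<Rightarrow> 'f \<times> nat \<Rightarrow> 'f \<times> nat" where
  "vertex_step D = (\<lambda>(f, k). glue D (f, (k + (gon D - 1)) mod gon D))"

lemma platonic_polygonal: "platonic_surface D \<Longrightarrow> polygonal_surface D"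
  by (simp add: platonic_surface_def)

section \<open>Automorphisms that are rotations on one face are symmetries\<close>

context surface
begin

text \<open>Centres have singleton classes, so they record which face goes to which.\<close>

lemma carries_centre:
  assumes "carries_face D F f f' g"
  shows "F {(f, 0)} = {(f', 0)}"
proof -
  have "F (pt D (f, 0)) = pt D (f', g 0)"
    using assms zero_in_polygon[OF gon_ge] by (simp add: carries_face_def)
  moreover have "g 0 = 0"
    using assms polygon_isometry_fixes_0[OF gon_ge] by (simp add: carries_face_def)
  ultimately show ?thesis by (simp add: pt_interior[OF gon_ge])
qed

text \<open>The images of the two representatives of an inner side point represent one point, hence
  are again the two representatives belonging to a pair of glued sides. The parameter
  \<open>u\<close> is left free because the second isometry might be a reflection.\<close>

lemma carries_side:
  assumes carries: "\<And>f. f \<in> faces D \<Longrightarrow> carries_face D F f (\<sigma> f) (G f)"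
    and inj: "inj_on F (points D)"
    and s: "(f, k) \<in> sides D" "glue D (f, k) = (f', k')" and t: "0 < t" "t < 1" and u: "0 < u" "u < 1"
    and G: "G f (side_point p k t) = side_point p j t" "G f' (side_point p k' (1 - t)) = side_point p j' u"
  shows "glue D (\<sigma> f, j mod p) = (\<sigma> f', j' mod p)" "u = 1 - t"
proof -
  have f: "f \<in> faces D" "f' \<in> faces D" using s(1) fst_glue_in_faces[OF s(1)] s(2) by (auto simp: sides_def)
  have \<sigma>f: "\<sigma> f \<in> faces D" using carries[OF f(1)] by (simp add: carries_face_def)
  have centre: "{(f, 0)} \<in> points D" if "f \<in> faces D" for f
    using pt_in_points[OF that zero_in_polygon[OF gon_ge]] by (simp add: pt_interior[OF gon_ge])
  have F: "F (pt D (g, z)) = pt D (\<sigma> g, G g z)" if "g \<in> faces D" "z \<in> regular_polygon p" for g z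
    using carries[OF that(1)] that(2) by (simp add: carries_face_def)
  have "((f, side_point p k t), (f', side_point p k' (1 - t))) \<in> glue_rel D"
    using glue_relI[OF s] t by simp
  then have "F (pt D (f, side_point p k t)) = F (pt D (f', side_point p k' (1 - t)))"
    by (simp add: pt_glue)
  then have "pt D (\<sigma> f, side_point p j t) = pt D (\<sigma> f', side_point p j' u)"
    using F f t by (simp add: side_point_in_polygon G)
  then have mem: "(\<sigma> f', side_point p j' u) \<in> pt D (\<sigma> f, side_point p (j mod p) t)"
    using pt_refl by (simp add: side_point_mod)
  obtain h i where gl: "glue D (\<sigma> f, j mod p) = (h, i)" by fastforce
  have side: "(\<sigma> f, j mod p) \<in> sides D" using \<sigma>f by (simp add: sides_def)
  have i: "i < p" using glue_in_sides[OF side] gl by (simp add: sides_def)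
  \<comment> \<open>Coinciding images would force \<open>f = f'\<close> by injectivity on the
    centres, and then \<open>k = k'\<close> since isometries are injective: a side glued to
    itself.\<close>
  have ne: "\<not> (\<sigma> f' = \<sigma> f \<and> side_point p j' u = side_point p j t)"
  proof
    assume *: "\<sigma> f' = \<sigma> f \<and> side_point p j' u = side_point p j t"
    have "F {(f, 0)} = F {(f', 0)}"
      using carries_centre[OF carries[OF f(1)]] carries_centre[OF carries[OF f(2)]] * by simp
    from inj_onD[OF inj this centre[OF f(1)] centre[OF f(2)]] have "f = f'" by simp
    then have "G f (side_point p k t) = G f (side_point p k' (1 - t))" using G * by simp
    moreover have "dist (G f z) (G f w) = dist z w" for z w
      using carries[OF f(1)] by (simp add: carries_face_def plane_isometry_def)
    ultimately have eq: "side_point p k' (1 - t) = side_point p k t"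
      by (metis dist_eq_0_iff)
    have "k mod p = k' mod p" using side_point_eqD(2)[OF gon_ge t eq] by simp
    then have "k = k'" using s(1) glue_in_sides[OF s(1)] s(2) by (auto simp: sides_def)
    then show False using \<open>f = f'\<close> s glue_neq by auto
  qed
  then have "\<sigma> f' = h" and eq: "side_point p j' u = side_point p i (1 - t)"
    using mem pt_side_point[OF side gl t] by (auto simp: side_point_mod)
  show "u = 1 - t" using side_point_eqD(1)[OF gon_ge _ _ eq] t by simp
  have "j' mod p = i" using side_point_eqD(2)[OF gon_ge _ _ eq] t i by simp
  then show "glue D (\<sigma> f, j mod p) = (\<sigma> f', j' mod p)" using gl \<open>\<sigma> f' = h\<close> by simp
qed

text \<open>Comparing the images of the point dividing a side in the ratio 1:3 shows that an automorphism
  cannot preserve the orientation of one face and reverse that of a neighbour.\<close>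

lemma automorphism_rotation:
  assumes F: "F \<in> automorphisms D" and f0: "f0 \<in> faces D"
    and carries0: "carries_face D F f0 f0' ((*) (\<zeta> ^ a0))"
  shows "\<exists>\<sigma> a. symmetry D \<sigma> a \<and> F = rot_map D \<sigma> a \<and> \<sigma> f0 = f0' \<and> a f0 = a0"
proof -
  \<comment> \<open>Image face and isometry are chosen freely except at \<open>f0\<close>, where the
    given ones are imposed so that the conclusion can name them.\<close>
  have "\<exists>f' g. carries_face D F f f' g \<and> (f = f0 \<longrightarrow> f' = f0' \<and> g = (*) (\<zeta> ^ a0))" if "f \<in> faces D" for f
    using F that carries0 by (cases "f = f0") (auto simp: automorphisms_def)
  then obtain \<sigma> G where
    *: "\<And>f. f \<in> faces D \<Longrightarrow> carries_face D F f (\<sigma> f) (G f) \<and> (f = f0 \<longrightarrow> \<sigma> f = f0' \<and> G f = (*) (\<zeta> ^ a0))"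
    by metis
  then have carries: "\<And>f. f \<in> faces D \<Longrightarrow> carries_face D F f (\<sigma> f) (G f)"
    and \<sigma>0: "\<sigma> f0 = f0'" "G f0 = (*) (\<zeta> ^ a0)" using f0 by auto
  have inj: "inj_on F (points D)" using F by (simp add: automorphisms_def Bij_def bij_betw_def)
  have side: "\<exists>k. G f' = (*) (\<zeta> ^ k)"
    if s: "(f, k) \<in> sides D" "glue D (f, k) = (f', k')" and a: "G f = (*) (\<zeta> ^ a)" for f k f' k' a
  proof -
    have "f' \<in> faces D" using fst_glue_in_faces[OF s(1)] s(2) by simp
    then have "plane_isometry (G f')" "G f' ` regular_polygon p = regular_polygon p"
      using carries[of f'] by (auto simp: carries_face_def)
    then show ?thesis
    proof (cases rule: polygon_isometry_cases[OF gon_ge, consumes 2, case_names rotation reflection])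
      case (reflection u b)
      then obtain j where "G f' (side_point p k' (1 - 1 / 4)) = side_point p j (1 - (1 - 1 / 4))"
        using reflection_side_point[of u p b k'] by auto
      then have "G f' (side_point p k' (1 - 1 / 4)) = side_point p j (1 / 4)" by simp
      moreover have "G f (side_point p k (1 / 4)) = side_point p (k + a) (1 / 4)"
        by (simp add: a side_point_add)
      \<comment> \<open>The rotation keeps the parameter 1/4, so gluing demands 3/4 on the other
        face, where the reflection has produced 1/4.\<close>
      ultimately have "(1 / 4 :: real) = 1 - 1 / 4"
        by (intro carries_side(2)[OF carries inj s, of "1 / 4" "1 / 4"]) auto
      then show ?thesis by simp
    qed auto
  qed
  have "\<exists>k. G f = (*) (\<zeta> ^ k)" if "f \<in> faces D" for f
  proof -
    from parallel_connected[OF f0 that] obtain t where "parallel D f0 t f" ..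
    then show ?thesis
    proof (induction rule: parallel_induct)
      case refl
      then show ?case using \<sigma>0 by auto
    next
      case (step t s)
      then show ?case using side[of "fst s" "snd s" "fst (glue D s)" "snd (glue D s)"] by auto
    qed
  qed
  then have "\<exists>k. G f = (*) (\<zeta> ^ k) \<and> (f = f0 \<longrightarrow> k = a0)" if "f \<in> faces D" for f
    using that \<sigma>0 by (cases "f = f0") auto
  then obtain a where a: "\<And>f. f \<in> faces D \<Longrightarrow> G f = (*) (\<zeta> ^ a f) \<and> (f = f0 \<longrightarrow> a f = a0)" by metis
  have "glue D (rot_side D \<sigma> a s) = rot_side D \<sigma> a (glue D s)" if s: "s \<in> sides D" for s
  proof -
    obtain f k f' k' where fk: "s = (f, k)" "glue D s = (f', k')" by fastforce
    have f: "f \<in> faces D" "f' \<in> faces D" using s fst_glue_in_faces[OF s] fk by (auto simp: sides_def)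
    have "G f (side_point p k (1 / 4)) = side_point p (k + a f) (1 / 4)"
      "G f' (side_point p k' (1 - 1 / 4)) = side_point p (k' + a f') (1 - 1 / 4)"
      using a f by (simp_all add: side_point_add)
    from carries_side(1)[OF carries inj _ _ _ _ _ _ this] s fk
    show ?thesis by (simp add: rot_side_def)
  qed
  then have sym: "symmetry D \<sigma> a"
    using carries by (auto simp: symmetry_def carries_face_def)
  have "F = rot_map D \<sigma> a"
  proof
    fix X
    show "F X = rot_map D \<sigma> a X"
    proof (cases "X \<in> points D")
      case True
      then obtain f z where X: "f \<in> faces D" "z \<in> regular_polygon p" "X = pt D (f, z)" by (rule pointsE)
      then show ?thesis
        using carries[OF X(1)] a[OF X(1)] rot_map_pt[OF sym X(1,2)] by (simp add: carries_face_def)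
    next
      case False
      then show ?thesis using F by (simp add: automorphisms_def Bij_def extensional_def rot_map_def)
    qed
  qed
  then show ?thesis using sym \<sigma>0(1) a[OF f0] by blast
qed

text \<open>A conjugate linear map is complex affine only if it vanishes, so the isometry on one
  face is a rotation; \<open>automorphism_rotation\<close> extends this to all faces.\<close>

lemma RotE:
  assumes "F \<in> carrier (Rot D)"
  obtains \<sigma> a where "symmetry D \<sigma> a" "F = rot_map D \<sigma> a"
proof -
  obtain f where f: "f \<in> faces D" using polygonal by (auto simp: polygonal_surface_def)
  have F: "F \<in> automorphisms D" using assms by (simp add: Rot_def)
  obtain f' g where g: "carries_face D F f f' g" "orientation_preserving g"
    using assms f by (auto simp: Rot_def)
  have "plane_isometry g" "g ` regular_polygon p = regular_polygon p"
    using g(1) by (auto simp: carries_face_def)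
  then obtain k where "g = (*) (\<zeta> ^ k)"
  proof (cases rule: polygon_isometry_cases[OF gon_ge, consumes 2, case_names rotation reflection])
    case (reflection u b)
    obtain v w where "g = (\<lambda>z. v * z + w)" using g(2) by (auto simp: orientation_preserving_def)
    with reflection have *: "u * cnj z = v * z + w" for z by metis
    have "u = 0" using *[of 0] *[of 1] *[of \<i>] by (auto simp: complex_eq_iff)
    with reflection show ?thesis by simp
  qed blast
  then show ?thesis using automorphism_rotation[OF F f] g(1) that by blast
qed

text \<open>Both flags use the initial corner of their side. An automorphism respecting this keeps
  the direction of the side, and a reflection would reverse it, so flag transitivity yields a
  rotation.\<close>

lemma platonic_transitive:
  assumes "platonic_surface D" "(f, k) \<in> sides D" "(f', k') \<in> sides D"
  obtains \<sigma> a where "symmetry D \<sigma> a" "\<sigma> f = f'" "(k + a f) mod p = k'"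
proof -
  have "(f, k, corner p k) \<in> flags D" "(f', k', corner p k') \<in> flags D"
    using assms(2,3) by (auto simp: flags_def)
  then obtain F where F: "F \<in> carrier (Aut D)" "carries_flag D F (f, k, corner p k) (f', k', corner p k')"
    using assms(1) by (auto simp: platonic_surface_def)
  then obtain g where g: "carries_face D F f f' g" "g (corner p k) = corner p k'"
    "g ` closed_segment (corner p k) (corner p (Suc k)) = closed_segment (corner p k') (corner p (Suc k'))"
    by (auto simp: carries_flag_def)
  have F': "F \<in> automorphisms D" using F(1) by (simp add: Aut_def)
  have f: "f \<in> faces D" "k' < p" using assms by (auto simp: sides_def)
  have "plane_isometry g" "g ` regular_polygon p = regular_polygon p"
    using g(1) by (auto simp: carries_face_def)
  then obtain i where i: "g = (*) (\<zeta> ^ i)"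
  proof (cases rule: polygon_isometry_cases[OF gon_ge, consumes 2, case_names rotation reflection])
    case (reflection u b)
    obtain j where j: "\<And>t. g (side_point p k t) = side_point p j (1 - t)" "g (corner p k) = corner p (Suc j)"
      using reflection_side_point[OF reflection(2) gon_pos, of k] reflection(1) by auto
    have "corner p (Suc k') \<in> g ` closed_segment (corner p k) (corner p (Suc k))"
      unfolding g(3) by simp
    then obtain t where t: "0 \<le> t" "t \<le> 1" "corner p (Suc k') = side_point p j (1 - t)"
      unfolding linepath_image_01[symmetric] using j(1) by (auto simp: side_point_def)
    \<comment> \<open>The end of the image side is a corner, so \<open>t\<close> is 0 or 1. Then two
      corners one or two steps apart coincide, which \<open>3 \<le> p\<close> excludes.\<close>
    have "\<not> (0 < t \<and> t < 1)"
      using norm_side_point_less[OF gon_ge, of "1 - t" j] t(3) norm_corner[of p "Suc k'"] by fastforce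
    then consider "t = 0" | "t = 1" using t by linarith
    then show ?thesis
    proof cases
      case 1
      then have "corner p (Suc k') = corner p k'" using t(3) j(2) g(2) by simp
      then have "\<zeta> ^ 1 = \<zeta> ^ 0" using corner_add[of p k' 1] by simp
      then show ?thesis using gon_ge by (simp only: root_of_unity_power_eq_iff[OF gon_pos]) simp
    next
      case 2
      then have "corner p (Suc k') = corner p j" using t(3) by simp
      moreover have "corner p k' = corner p (Suc j)" using j(2) g(2) by simp
      ultimately have "\<zeta> * (\<zeta> * corner p k') = corner p k'"
        using corner_add[of p k' 1] corner_add[of p j 1] by simp
      then have "\<zeta> ^ 2 = \<zeta> ^ 0" by (simp add: power2_eq_square)
      then show ?thesis using gon_ge by (simp only: root_of_unity_power_eq_iff[OF gon_pos]) simp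
    qed
  qed blast
  have "corner p (k + i) = corner p k'" using g(2) by (simp add: i corner_add)
  then have "(k + i) mod p = k'" using f by (simp add: corner_eq_iff)
  with automorphism_rotation[OF F' f(1), of f' i] g(1) i that show ?thesis by blast
qed

section \<open>The walk around a vertex and its holonomy\<close>

lemma vertex_step_in_sides: "s \<in> sides D \<Longrightarrow> vertex_step D s \<in> sides D"
  using glue_in_sides by (auto simp: vertex_step_def sides_def)

lemma vertex_step_inj: "inj_on (vertex_step D) (sides D)"
proof (rule inj_onI)
  fix s s' assume *: "s \<in> sides D" "s' \<in> sides D" "vertex_step D s = vertex_step D s'"
  obtain f k f' k' where s: "s = (f, k)" "s' = (f', k')" by fastforce
  have "(f, (k + (p - 1)) mod p) = (f', (k' + (p - 1)) mod p)"
    using * s glue_glue[of "(f, (k + (p - 1)) mod p)"] glue_glue[of "(f', (k' + (p - 1)) mod p)"]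
    by (auto simp: vertex_step_def sides_def)
  then have "f = f'" "\<zeta> ^ (k + (p - 1)) = \<zeta> ^ (k' + (p - 1))"
    by (auto simp: root_of_unity_power_eq_iff)
  then show "s = s'" using * s by (auto simp: power_add root_of_unity_power_eq_iff sides_def)
qed

lemma corner_pred: "corner p (Suc ((k + (p - 1)) mod p)) = corner p k"
  using gon_pos by (simp add: corner_eq_iff mod_simps del: gon_pos)

lemma Suc_mod_pred:
  assumes "j < p"
  shows "(Suc j mod p + (p - 1)) mod p = j"
proof -
  have "(Suc j mod p + (p - 1)) mod p = (Suc j + (p - 1)) mod p" by (rule mod_add_left_eq)
  also have "Suc j + (p - 1) = j + p" using gon_pos by linarith
  finally show ?thesis using assms by simp
qed

lemma vertex_step_pt:
  assumes "(f, k) \<in> sides D" "vertex_step D (f, k) = (f', k')"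
  shows "((f, corner p k), (f', corner p k')) \<in> glue_rel D"
proof -
  have "(f, (k + (p - 1)) mod p) \<in> sides D" "glue D (f, (k + (p - 1)) mod p) = (f', k')"
    using assms by (auto simp: vertex_step_def sides_def)
  from glue_relI[OF this, of 1] show ?thesis
    unfolding side_point_1 corner_pred by simp
qed

text \<open>Every gluing at a corner moves one step forward or backward around the vertex, so the
  corners of the orbit form a set closed under gluing.\<close>

lemma vertex_fibre_orbit:
  assumes s: "s \<in> sides D" "s = (f, k)"
  shows "{(f', k'). (f', k') \<in> sides D \<and> pt D (f', corner p k') = pt D (f, corner p k)} =
    range (\<lambda>n. (vertex_step D ^^ n) s)" (is "?V = ?O")
proof
  have O: "?O \<subseteq> sides D"
  proof
    fix u assume "u \<in> ?O"
    then obtain n where "u = (vertex_step D ^^ n) s" by blast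
    then show "u \<in> sides D"
      by (induction n arbitrary: u) (simp_all add: s(1) vertex_step_in_sides)
  qed
  have step: "vertex_step D ` ?O \<subseteq> ?O"
  proof
    fix u assume "u \<in> vertex_step D ` ?O"
    then obtain n where "u = vertex_step D ((vertex_step D ^^ n) s)" by blast
    then have "u = (vertex_step D ^^ Suc n) s" by simp
    then show "u \<in> ?O" by blast
  qed
  have "finite ?O" using O finite_sides finite_subset by blast
  \<comment> \<open>Injectivity on a finite orbit makes the step surjective, which supplies the
    backward moves.\<close>
  then have surj: "vertex_step D ` ?O = ?O"
    using endo_inj_surj step inj_on_subset[OF vertex_step_inj O] by blast
  have "(vertex_step D ^^ n) s \<in> ?V" for n
  proof (induction n)
    case (Suc n)
    obtain a b a' b' where ab: "(vertex_step D ^^ n) s = (a, b)" "vertex_step D (a, b) = (a', b')"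
      by fastforce
    then have "(a, b) \<in> sides D" using O by (metis rangeI subsetD)
    then show ?case
      using Suc ab vertex_step_in_sides[of "(a, b)"] pt_glue[OF vertex_step_pt[of a b a' b']] by auto
  qed (use s in auto)
  then show "?O \<subseteq> ?V" by (rule image_subsetI)
  define W where "W = (\<lambda>(f, k). (f, corner p k)) ` ?O"
  have "pt D (f, corner p k) \<subseteq> W"
  proof (rule pt_subset)
    show "(f, corner p k) \<in> W" unfolding W_def using s by (intro image_eqI[of _ _ s]) (auto intro: range_eqI[of _ _ 0])
    fix b c assume "b \<in> W" and "(b, c) \<in> glue_rel D"
    then obtain g i where gi: "(g, i) \<in> ?O" "b = (g, corner p i)" by (force simp: W_def)
    then have gi': "(g, i) \<in> sides D" using O by blast
    obtain g1 j g2 j' t where *: "(g1, j) \<in> sides D" "glue D (g1, j) = (g2, j')" "0 \<le> t" "t \<le> 1"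
      "b = (g1, side_point p j t)" "c = (g2, side_point p j' (1 - t))"
      using \<open>(b, c) \<in> glue_rel D\<close> by (rule glue_relE)
    have eq: "g1 = g" "side_point p j t = corner p i" using * gi by auto
    have ij: "i < p" "j < p" "j' < p" using gi' * glue_in_sides[OF *(1)] by (auto simp: sides_def)
    have "\<not> (0 < t \<and> t < 1)"
      using norm_side_point_less[OF gon_ge, of t j] eq norm_corner[of p i] by fastforce
    \<comment> \<open>A corner lies on two sides: \<open>t = 0\<close> crosses the side starting
      there, a backward step, and \<open>t = 1\<close> the side ending there, a forward
      step.\<close>
    then consider "t = 0" | "t = 1" using * by linarith
    then show "c \<in> W"
    proof cases
      case 1
      then have "i = j" using eq ij by (simp add: corner_eq_iff)
      define r where "r = Suc j' mod p"
      have r: "(g2, r) \<in> sides D" using glue_in_sides[OF *(1)] * by (auto simp: sides_def r_def)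
      have "(r + (p - 1)) mod p = j'" using Suc_mod_pred[OF ij(3)] by (simp add: r_def)
      then have "vertex_step D (g2, r) = (g, i)"
        using glue_glue[OF *(1)] * eq \<open>i = j\<close> by (simp add: vertex_step_def)
      then obtain u where u: "u \<in> ?O" "vertex_step D (g2, r) = vertex_step D u"
        using gi(1) surj by (metis (no_types, lifting) imageE)
      then have "(g2, r) \<in> ?O" using inj_onD[OF vertex_step_inj u(2) r] O by blast
      moreover have "c = (g2, corner p r)" using * 1 by (simp add: r_def corner_mod)
      ultimately show ?thesis unfolding W_def by force
    next
      case 2
      then have "corner p i = corner p (Suc j)" using eq by simp
      then have "i = Suc j mod p" using ij by (simp add: corner_eq_iff)
      then have "(i + (p - 1)) mod p = j" using Suc_mod_pred[OF ij(2)] by simp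
      then have "vertex_step D (g, i) = (g2, j')" using * eq by (simp add: vertex_step_def)
      then have "(g2, j') \<in> ?O" using gi(1) step by (metis image_subset_iff)
      moreover have "c = (g2, corner p j')" using * 2 by simp
      ultimately show ?thesis unfolding W_def by force
    qed
  qed
  then have W: "pt D (f, corner p k) \<subseteq> W" .
  show "?V \<subseteq> ?O"
  proof safe
    fix g i assume gi: "(g, i) \<in> sides D" "pt D (g, corner p i) = pt D (f, corner p k)"
    then have "(g, corner p i) \<in> W" using W pt_refl by blast
    then obtain j where j: "(g, j) \<in> ?O" "corner p i = corner p j" by (force simp: W_def)
    then have "(g, j) \<in> sides D" using O by blast
    then have "i = j" using gi j(2) by (auto simp: corner_eq_iff sides_def)
    then show "(g, i) \<in> ?O" using j by simp
  qed
qed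

text \<open>Each step turns through the interior angle \<open>pi - 2 * pi / p\<close>, and
  \<open>- \<zeta>\<close> is the inverse of its \<open>cis\<close>. The factor
  \<open>\<zeta> ^ l / \<zeta> ^ k\<close> compares the charts by the final and the initial side and
  disappears when the walk closes.\<close>

lemma vertex_step_parallel:
  assumes "(f, k) \<in> sides D"
  shows "\<exists>g l. (g, l) \<in> sides D \<and> (vertex_step D ^^ n) (f, k) = (g, l) \<and>
    parallel D f ((- \<zeta>) ^ n * \<zeta> ^ l / \<zeta> ^ k) g"
proof (induction n)
  case 0
  show ?case using assms parallel_refl by (auto simp: sides_def)
next
  case (Suc n)
  then obtain g l where gl: "(g, l) \<in> sides D" "(vertex_step D ^^ n) (f, k) = (g, l)"
    "parallel D f ((- \<zeta>) ^ n * \<zeta> ^ l / \<zeta> ^ k) g" by blast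
  define j where "j = (l + (p - 1)) mod p"
  obtain g' l' where gl': "glue D (g, j) = (g', l')" by fastforce
  have gj: "(g, j) \<in> sides D" using gl by (auto simp: sides_def j_def)
  have "\<zeta> ^ j * \<zeta> = \<zeta> ^ (l + p)"
    unfolding j_def root_of_unity_power_mod[OF gon_pos] power_Suc2[symmetric] using gon_pos
    by (metis Suc_pred' add_Suc_right One_nat_def)
  then have j: "\<zeta> ^ l = \<zeta> ^ j * \<zeta>" by (simp add: power_add root_of_unity_power_gon)
  have "parallel D g (- (\<zeta> ^ l' / \<zeta> ^ j)) g'"
    using parallel_step[OF gj] by (simp add: turn_conv gl')
  from parallel_trans[OF gl(3) this]
  have "parallel D f ((- \<zeta>) ^ Suc n * \<zeta> ^ l' / \<zeta> ^ k) g'" by (simp add: j field_simps)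
  moreover have "(vertex_step D ^^ Suc n) (f, k) = (g', l')"
    using gl gl' by (simp add: vertex_step_def j_def)
  ultimately show ?case using glue_in_sides[OF gj] gl' by auto
qed

text \<open>The degree counts the orbit of a side under \<open>vertex_step\<close>, so the walk
  closes after \<open>q\<close> steps.\<close>

lemma vertex_holonomy:
  assumes "schlafli_symbol D m q" "f \<in> faces D"
  shows "parallel D f ((- \<zeta>) ^ q) f"
proof -
  have s: "(f, 0) \<in> sides D" using assms(2) by (simp add: sides_def)
  have "vertex_degree D (pt D (f, corner p 0)) = q"
    using assms(1) s by (auto simp: schlafli_symbol_def vertices_def)
  then have "card (range (\<lambda>n. (vertex_step D ^^ n) (f, 0))) = q"
    using vertex_fibre_orbit[OF s refl] by (simp add: vertex_degree_def)
  then have "(vertex_step D ^^ q) (f, 0) = (f, 0)"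
    using funpow_orbit_card[OF finite_sides s _ vertex_step_inj] vertex_step_in_sides by blast
  then show ?thesis using vertex_step_parallel[OF s, of q] by auto
qed

end


section \<open>Rotations of the unfolding\<close>

text \<open>The second component makes the lift, with shift \<open>a f\<close> on the face \<open>(f, h)\<close>, preserve global
  directions.\<close>

definition lift_face :: "'f poly_surface \<Rightarrow> ('f \<Rightarrow> 'f) \<Rightarrow> ('f \<Rightarrow> nat) \<Rightarrow> 'f \<times> complex \<Rightarrow> 'f \<times> complex" where
  "lift_face D \<sigma> a = (\<lambda>(f, h). (\<sigma> f, h * root_of_unity (gon D) ^ a f))"

text \<open>The numbers \<open>\<plusminus> \<zeta> ^ j\<close>, described uniformly in the parity of \<open>p\<close>. This form makes \<open>u ^ p\<close> the face
  of \<open>\<Pi>\<^sub>p\<close> belonging to the heading \<open>u\<close>.\<close>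

definition signed_root :: "nat \<Rightarrow> complex \<Rightarrow> bool" where
  "signed_root p u \<longleftrightarrow> u ^ p = 1 \<or> u ^ p = (- 1) ^ p"

lemma minus_one_power_square: "((- 1) ^ n :: complex) * (- 1) ^ n = 1"
  by (simp flip: power_mult_distrib)

lemma signed_root_mult: "signed_root p u \<Longrightarrow> signed_root p v \<Longrightarrow> signed_root p (u * v)"
  unfolding signed_root_def by (auto simp: power_mult_distrib minus_one_power_square)

lemma divide_minus_one_power: "z / (- 1) ^ n = (- 1) ^ n * (z :: complex)"
  by (cases "even n") auto

lemma signed_root_divide: "signed_root p u \<Longrightarrow> signed_root p v \<Longrightarrow> signed_root p (u / v)"
  unfolding signed_root_def power_divide
  by (elim disjE) (simp_all only: divide_minus_one_power div_by_1 minus_one_power_square mult_1_right simp_thms)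

lemma signed_root_power:
  assumes "0 < p"
  shows "signed_root p ((- 1) ^ i * root_of_unity p ^ j)"
proof -
  have "((- 1) ^ i * root_of_unity p ^ j) ^ p = ((- 1) ^ p) ^ i"
    unfolding power_mult_distrib root_of_unity_power_power[OF assms] mult_1_right
    by (simp only: mult.commute flip: power_mult)
  then show ?thesis by (cases "even p"; cases "even i") (auto simp: signed_root_def)
qed

locale unfolding_of = surface +
  fixes f0
  assumes f0: "f0 \<in> faces D"
begin

abbreviation E :: "('a \<times> complex) poly_surface" where "E \<equiv> unfolding_surface D f0"

lemma gon_E [simp]: "gon E = p"
  by (simp add: unfolding_surface_def)

lemma faces_E: "(f, h) \<in> faces E \<longleftrightarrow> parallel D f0 h f"
  by (simp add: unfolding_surface_def parallel_def)

lemma glue_E: "glue E ((f, h), k) = ((fst (glue D (f, k)), h * turn D (f, k)), snd (glue D (f, k)))"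
  by (simp add: unfolding_surface_def)

lemma turn_E: "turn E ((f, h), k) = turn D (f, k)"
  by (simp add: turn_def glue_E)

lemma sides_E: "((f, h), k) \<in> sides E \<Longrightarrow> parallel D f0 h f \<and> (f, k) \<in> sides D"
  using parallel_in_faces by (auto simp: sides_def faces_E)

lemma glue_E_in_sides:
  assumes "((f, h), k) \<in> sides E"
  shows "glue E ((f, h), k) \<in> sides E"
proof -
  have s: "parallel D f0 h f" "(f, k) \<in> sides D" using sides_E[OF assms] by auto
  show ?thesis
    using parallel_trans[OF s(1)] parallel_step[OF s(2)] glue_in_sides[OF s(2)]
    by (auto simp: sides_def glue_E faces_E)
qed

text \<open>Path lifting: the second component accumulates the transport, so \<open>t\<close>
  determines the end of the lift.\<close>

lemma parallel_lift:
  assumes "(f, h) \<in> faces E" "parallel D f t g"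
  shows "parallel E (f, h) t (g, h * t)"
  using assms(2)
proof (induction rule: parallel_induct)
  case refl
  show ?case using parallel_refl[OF assms(1)] by simp
next
  case (step t s)
  obtain g k where s: "s = (g, k)" by fastforce
  have "parallel D f0 (h * t) g" using parallel_trans step.hyps(1) assms(1) s by (simp add: faces_E)
  then have side: "((g, h * t), k) \<in> sides E" using step.hyps(2) s by (auto simp: sides_def faces_E)
  have "fst (glue E ((g, h * t), k)) \<in> faces E" using glue_E_in_sides[OF side] by (auto simp: sides_def)
  then have "parallel E (g, h * t) (turn D s) (fst (glue D s), h * t * turn D s)"
    unfolding parallel_def using side s
    by (intro exI[of _ "[((g, h * t), k)]"]) (simp add: transport_def turn_E glue_E)
  with step.IH show ?case using parallel_trans s by (fastforce simp: mult.assoc)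
qed

lemma polygonal_E: "polygonal_surface E"
  unfolding polygonal_surface_def
proof (intro conjI ballI)
  show "3 \<le> gon E" by (simp add: gon_ge)
  \<comment> \<open>Transports are \<open>2 * p\<close>-th roots of unity, so only finitely many
    copies of each face occur.\<close>
  have "h ^ (2 * p) = 1" if fh: "(f, h) \<in> faces E" for f h
  proof -
    have "signed_root p h"
      using parallel_value signed_root_power[OF gon_pos] fh unfolding faces_E by blast
    then have "h ^ p * h ^ p = 1" by (auto simp: signed_root_def minus_one_power_square)
    then show ?thesis by (simp add: mult_2 power_add)
  qed
  then have "faces E \<subseteq> faces D \<times> {h. h ^ (2 * p) = 1}"
    using parallel_in_faces by (auto simp: faces_E)
  moreover have "finite {h :: complex. h ^ (2 * p) = 1}"
    using gon_ge by (intro finite_roots_unity) simp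
  ultimately show "finite (faces E)"
    using polygonal finite_subset by (fastforce simp: polygonal_surface_def)
  show "faces E \<noteq> {}" using parallel_refl[OF f0] faces_E by blast
next
  fix s assume s: "s \<in> sides E"
  obtain f h k where fhk: "s = ((f, h), k)" by (metis surj_pair)
  have fk: "(f, k) \<in> sides D" using sides_E s fhk by blast
  show "glue E s \<in> sides E" using glue_E_in_sides s fhk by blast
  show "glue E s \<noteq> s" using glue_neq[OF fk] by (auto simp: fhk glue_E prod_eq_iff)
  show "glue E (glue E s) = s"
    using glue_glue[OF fk] turn_glue[OF fk] turn_nonzero[of "(f, k)"] by (simp add: fhk glue_E)
next
  fix x y assume xy: "x \<in> faces E" "y \<in> faces E"
  obtain f h g i where fh: "x = (f, h)" "y = (g, i)" by fastforce
  have "parallel D f0 h f" "parallel D f0 i g" using xy fh by (auto simp: faces_E)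
  then have "parallel D f (1 / h * i) g" by (intro parallel_trans[OF parallel_sym])
  from parallel_lift[OF _ this, of h] have "parallel E x (1 / h * i) (g, h * (1 / h * i))"
    using xy fh by simp
  then show "\<exists>ss. gallery E x ss y"
    using fh parallel_nonzero[OF \<open>parallel D f0 h f\<close>] by (auto simp: parallel_def)
qed

sublocale E: surface E
  by unfold_locales (rule polygonal_E)

text \<open>One face landing in the unfolding suffices: any other face is joined to it by a gallery,
  whose image under the symmetry has the transport required by the lift.\<close>

lemma symmetry_lift:
  assumes "symmetry D \<sigma> a" "(f1, h1) \<in> faces E" "lift_face D \<sigma> a (f1, h1) \<in> faces E"
  shows "symmetry E (lift_face D \<sigma> a) (\<lambda>x. a (fst x))"
  unfolding symmetry_def
proof (intro conjI ballI subsetI)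
  fix x assume "x \<in> lift_face D \<sigma> a ` faces E"
  then obtain f h where fh: "(f, h) \<in> faces E" "x = lift_face D \<sigma> a (f, h)" by fastforce
  have h1: "h1 \<noteq> 0" using assms(2) parallel_nonzero by (auto simp: faces_E)
  have "parallel D f1 (1 / h1 * h) f"
    using assms(2) fh(1) unfolding faces_E by (intro parallel_trans[OF parallel_sym])
  from parallel_trans[OF _ parallel_symmetry[OF assms(1) this], of f0 "h1 * \<zeta> ^ a f1"]
  show "x \<in> faces E" using assms(3) h1 by (simp add: fh(2) lift_face_def faces_E)
next
  fix s assume s: "s \<in> sides E"
  obtain f h k where fhk: "s = ((f, h), k)" by (metis surj_pair)
  have fk: "(f, k) \<in> sides D" using sides_E s fhk by blast
  show "glue E (rot_side E (lift_face D \<sigma> a) (\<lambda>x. a (fst x)) s) =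
      rot_side E (lift_face D \<sigma> a) (\<lambda>x. a (fst x)) (glue E s)"
    using symmetry_glue[OF assms(1) fk] turn_rot_side[OF assms(1) fk]
    by (simp add: fhk rot_side_def lift_face_def glue_E case_prod_beta)
qed

text \<open>Gluings of the unfolding project to gluings of \<open>D\<close>, so the set to which
  \<open>the_elem\<close> is applied is a singleton.\<close>

lemma proj_D_pt:
  assumes "(f, h) \<in> faces E"
  shows "proj_D D (pt E ((f, h), z)) = pt D (f, z)"
proof -
  have "pt E ((f, h), z) \<subseteq> {((f', h'), z'). pt D (f', z') = pt D (f, z)}"
  proof (rule pt_subset)
    fix b c assume b: "b \<in> {((f', h'), z'). pt D (f', z') = pt D (f, z)}" and "(b, c) \<in> glue_rel E"
    from this(2) obtain x k x' k' t where *: "(x, k) \<in> sides E" "glue E (x, k) = (x', k')" "0 \<le> t" "t \<le> 1"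
      "b = (x, side_point (gon E) k t)" "c = (x', side_point (gon E) k' (1 - t))"
      by (rule glue_relE)
    obtain g i g' i' where g: "x = (g, i)" "x' = (g', i')" by fastforce
    have gk: "(g, k) \<in> sides D" "glue D (g, k) = (g', k')"
      using * g sides_E[of g i k] by (auto simp: glue_E prod_eq_iff)
    have "pt D (g, side_point p k t) = pt D (g', side_point p k' (1 - t))"
      by (intro pt_glue glue_relI[OF gk *(3,4)])
    then show "c \<in> {((f', h'), z'). pt D (f', z') = pt D (f, z)}" using b * g by simp
  qed simp
  then have "(\<lambda>((f, h), z). pt D (f, z)) ` pt E ((f, h), z) \<subseteq> {pt D (f, z)}" by fastforce
  moreover have "pt D (f, z) \<in> (\<lambda>((f, h), z). pt D (f, z)) ` pt E ((f, h), z)"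
    using pt_refl[of "((f, h), z)" E] by force
  ultimately have "(\<lambda>((f, h), z). pt D (f, z)) ` pt E ((f, h), z) = {pt D (f, z)}" by blast
  then show ?thesis by (simp add: proj_D_def)
qed

text \<open>Every point of \<open>D\<close> has a preimage in the unfolding, so the rotation below
  is unique; outside \<open>points D\<close> both candidates are \<open>undefined\<close>.\<close>

lemma phi_rot_map:
  assumes "symmetry D \<sigma> a" "symmetry E (lift_face D \<sigma> a) (\<lambda>x. a (fst x))"
  shows "phi D f0 (rot_map E (lift_face D \<sigma> a) (\<lambda>x. a (fst x))) = rot_map D \<sigma> a" (is "phi D f0 ?F = _")
proof -
  have commute: "proj_D D (?F (pt E ((f, h), z))) = rot_map D \<sigma> a (pt D (f, z))"
    if "(f, h) \<in> faces E" "z \<in> regular_polygon p" for f h z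
  proof -
    have "f \<in> faces D" using that(1) parallel_in_faces by (auto simp: faces_E)
    moreover have "(\<sigma> f, h * \<zeta> ^ a f) \<in> faces E"
      using E.symmetry_faces[OF assms(2) that(1)] by (simp add: lift_face_def)
    ultimately show ?thesis
      using E.rot_map_pt[OF assms(2) that(1)] rot_map_pt[OF assms(1)] that(2)
      by (simp add: lift_face_def proj_D_pt)
  qed
  have eq: "G = rot_map D \<sigma> a" if G: "G \<in> carrier (Rot D)"
    "\<forall>X\<in>points E. proj_D D (?F X) = G (proj_D D X)" for G
  proof
    fix X
    show "G X = rot_map D \<sigma> a X"
    proof (cases "X \<in> points D")
      case True
      then obtain f z where X: "f \<in> faces D" "z \<in> regular_polygon p" "X = pt D (f, z)" by (rule pointsE)
      from parallel_connected[OF f0 X(1)] obtain h where fh: "(f, h) \<in> faces E"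
        unfolding faces_E ..
      have "pt E ((f, h), z) \<in> points E" using E.pt_in_points[OF fh] X(2) by simp
      then show ?thesis using G(2) commute[OF fh X(2)] by (simp add: X(3) proj_D_pt[OF fh])
    next
      case False
      then show ?thesis
        using G(1) by (simp add: Rot_def automorphisms_def Bij_def extensional_def rot_map_def)
    qed
  qed
  have "\<forall>X\<in>points E. proj_D D (?F X) = rot_map D \<sigma> a (proj_D D X)"
  proof
    fix X assume "X \<in> points E"
    then obtain x z where X: "x \<in> faces E" "z \<in> regular_polygon p" "X = pt E (x, z)"
      by (rule E.pointsE) simp
    obtain f h where "x = (f, h)" by fastforce
    then show "proj_D D (?F X) = rot_map D \<sigma> a (proj_D D X)" using X commute by (simp add: proj_D_pt)
  qed
  then show ?thesis
    unfolding phi_def using rot_map_in_Rot[OF assms(1)] eq by (intro the_equality) auto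
qed

end

section \<open>Headings and the covering of \<open>\<Pi>\<^sub>p\<close>\<close>

lemma gon_Pi [simp]: "gon (Pi_surface p) = p"
  by (simp add: Pi_surface_def)

lemma fst_glue_Pi: "fst (glue (Pi_surface p) (s, k)) = (- 1) ^ p * s"
  by (simp add: Pi_surface_def)

lemma Pi_faces_power: "s \<in> faces (Pi_surface p) \<Longrightarrow> s ^ p = s \<and> s \<noteq> 0"
  by (auto simp: Pi_surface_def split: if_splits)

lemma signed_root_Pi: "signed_root p u \<Longrightarrow> u ^ p \<in> faces (Pi_surface p)"
  by (auto simp: signed_root_def Pi_surface_def)

locale horizontal_unfolding = unfolding_of +
  fixes c
  assumes horizontal: "horizontal_choice D f0 c"
begin

lemma signed_root_parallel: "parallel D f t g \<Longrightarrow> signed_root p t"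
  using parallel_value signed_root_power[OF gon_pos] by blast

text \<open>The horizontal side makes one heading times a power of \<open>\<zeta>\<close> real of
  norm 1, hence \<open>1\<close> or \<open>- 1\<close>. All other headings differ from it by
  quotients of transports.\<close>

lemma signed_root_heading:
  assumes "x \<in> faces E"
  shows "signed_root p (heading c x)"
proof -
  obtain y k where y: "y \<in> faces E" "cmod c = 1" "Im (heading c y * edge_vec p k) = 0"
    using horizontal by (auto simp: horizontal_choice_def sides_def)
  obtain g i f h where gi: "y = (g, i)" "x = (f, h)" by fastforce
  have i: "signed_root p i" "signed_root p h"
    using y(1) assms gi by (auto simp: faces_E intro: signed_root_parallel)
  have i0: "cmod i = 1"
    using parallel_value[of f0 i g] y(1) gi by (auto simp: faces_E norm_mult norm_power)
  define u where "u = c / i * \<zeta> ^ k"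
  have "cmod u = 1" by (simp add: u_def norm_mult norm_divide norm_power y i0)
  moreover have "Im u = 0"
  proof -
    have "heading c y * edge_vec p k = of_real (2 * sin (pi / p)) * u"
      unfolding edge_vec_conv_power[of p k] edge_vec_0 by (simp add: heading_def gi u_def)
    then show ?thesis using y(3) polygon_angle(1)[OF gon_ge] by (simp del: of_real_mult)
  qed
  ultimately have "u = 1 \<or> u = - 1"
    by (simp add: complex_eq_iff cmod_def abs_if split: if_splits)
  then have "signed_root p u" by (auto simp: signed_root_def)
  moreover have "signed_root p (\<zeta> ^ k)" by (simp add: signed_root_def root_of_unity_power_power)
  ultimately have "signed_root p (u / \<zeta> ^ k * i / h)"
    using i by (intro signed_root_divide signed_root_mult)
  moreover have "u / \<zeta> ^ k * i / h = heading c x" using i0 by (auto simp: u_def heading_def gi)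
  ultimately show ?thesis by simp
qed

text \<open>A heading \<open>u\<close> gives a translate of the polygon \<open>s\<close> exactly if
  \<open>(u / s) ^ p = 1\<close>, and \<open>s ^ p = s\<close> for the faces \<open>s\<close> of
  \<open>\<Pi>\<^sub>p\<close>.\<close>

lemma Pi_face_eq:
  assumes "x \<in> faces E"
  shows "Pi_face p c x = heading c x ^ p"
  unfolding Pi_face_def
proof (rule the_equality)
  let ?u = "heading c x"
  have eq: "(*) ?u ` regular_polygon p = (*) s ` regular_polygon p \<longleftrightarrow> ?u ^ p = s"
    if s: "s \<in> faces (Pi_surface p)" for s
  proof -
    have s0: "s ^ p = s" "s \<noteq> 0" using Pi_faces_power[OF s] by auto
    have "(*) ?u ` regular_polygon p = (*) s ` (*) (?u / s) ` regular_polygon p"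
      unfolding image_image using s0 by simp
    moreover have "inj ((*) s)" using s0 by (auto intro: injI)
    ultimately have "(*) ?u ` regular_polygon p = (*) s ` regular_polygon p \<longleftrightarrow>
        (*) (?u / s) ` regular_polygon p = regular_polygon p"
      by (simp add: inj_image_eq_iff)
    then show ?thesis unfolding unit_polygon_eq_iff[OF gon_ge] power_divide using s0 by simp
  qed
  show "?u ^ p \<in> faces (Pi_surface p) \<and> (*) ?u ` regular_polygon p = (*) (?u ^ p) ` regular_polygon p"
    using signed_root_Pi[OF signed_root_heading[OF assms]] eq by simp
  show "s = ?u ^ p" if "s \<in> faces (Pi_surface p) \<and> (*) ?u ` regular_polygon p = (*) s ` regular_polygon p" for s
    using eq[of s] that by blast
qed

lemma Pi_face_in_faces: "x \<in> faces E \<Longrightarrow> Pi_face p c x \<in> faces (Pi_surface p)"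
  using signed_root_Pi[OF signed_root_heading] by (simp add: Pi_face_eq)

lemma Pi_side_eq:
  assumes "x \<in> faces E"
  shows "\<exists>i. \<forall>j. Pi_side p c (x, j) = (Pi_face p c x, (j + i) mod p)"
proof -
  define s where "s = Pi_face p c x"
  have s: "s ^ p = s" "s \<noteq> 0" "heading c x ^ p = s"
    using Pi_faces_power[OF Pi_face_in_faces[OF assms]] Pi_face_eq[OF assms] by (auto simp: s_def)
  then have "(heading c x / s) ^ p = 1" by (simp add: power_divide)
  from ex_root_of_unity_power[OF gon_pos this] obtain i where "heading c x / s = \<zeta> ^ i" by blast
  then have i: "heading c x = s * \<zeta> ^ i" using s by (simp add: field_simps)
  have "(THE k. k < p \<and> heading c x * corner p j = s * corner p k) = (j + i) mod p" for j
  proof -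
    have "k < p \<and> heading c x * corner p j = s * corner p k \<longleftrightarrow> k = (j + i) mod p" for k
      using s(2) corner_add[of p j i, symmetric] corner_mod[OF gon_pos, of "j + i"]
      by (auto simp: i mult.assoc corner_eq_iff)
    then show ?thesis by simp
  qed
  then show ?thesis by (auto simp: Pi_side_def s_def)
qed

text \<open>The \<open>p\<close>-th power of a turn is \<open>(- 1) ^ p\<close>; accordingly,
  crossing a side exchanges \<open>P\<close> and \<open>- P\<close> for odd \<open>p\<close> and
  stays in the only face for even \<open>p\<close>.\<close>

lemma Pi_face_step:
  assumes "(x, j) \<in> sides E"
  shows "Pi_face p c (fst (glue E (x, j))) = fst (glue (Pi_surface p) (Pi_side p c (x, j)))"
proof -
  obtain f h where x: "x = (f, h)" by fastforce
  have "x \<in> faces E" "fst (glue E (x, j)) \<in> faces E"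
    using assms E.fst_glue_in_faces[OF assms] by (auto simp: sides_def)
  moreover have "turn D (f, j) ^ p = (- 1) ^ p"
    unfolding turn_conv by (subst power_minus) (simp add: power_divide root_of_unity_power_power)
  moreover have "w / (z * (- 1) ^ p) = (- 1) ^ p * w / (z :: complex)" for w z
    by (cases "even p") auto
  ultimately show ?thesis
    by (simp add: Pi_side_def fst_glue_Pi Pi_face_eq)
      (simp add: x glue_E heading_def power_divide power_mult_distrib mult.assoc)
qed

text \<open>Unique path lifting: on each face the side numbers are merely shifted, so every crossing
  has exactly one lift. The equivalence with \<open>z = y\<close> evaluates the \<open>THE\<close>
  in \<open>monodromy\<close>.\<close>

lemma lift_gallery:
  assumes "x \<in> faces E" "gallery (Pi_surface p) (Pi_face p c x) ws s"
  shows "\<exists>y\<in>faces E. Pi_face p c y = s \<and>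
    (\<forall>z. (\<exists>ss. gallery E x ss z \<and> map (Pi_side p c) ss = ws) \<longleftrightarrow> z = y)"
  using assms
proof (induction ws arbitrary: x)
  case Nil
  then show ?case by auto
next
  case (Cons w ws)
  obtain k where w: "w = (Pi_face p c x, k)" "k < p"
    using Cons.prems(2) by (auto simp: sides_def)
  obtain i where i: "\<And>j. Pi_side p c (x, j) = (Pi_face p c x, (j + i) mod p)"
    using Pi_side_eq[OF Cons.prems(1)] by blast
  obtain j where j: "j < p" "(j + i) mod p = k" using ex_shift_mod[OF w(2)] by blast
  have uniq: "j' = j" if "j' < p" "(j' + i) mod p = k" for j'
  proof -
    have "\<zeta> ^ (j' + i) = \<zeta> ^ (j + i)" using that j by (simp add: root_of_unity_power_eq_iff)
    then have "\<zeta> ^ j' = \<zeta> ^ j" by (simp add: power_add)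
    then show ?thesis using that j by (simp add: root_of_unity_power_eq_iff)
  qed
  have side: "(x, j) \<in> sides E" using Cons.prems(1) j by (simp add: sides_def)
  have w': "Pi_side p c (x, j) = w" using i j w by simp
  define x' where "x' = fst (glue E (x, j))"
  have "x' \<in> faces E" using E.fst_glue_in_faces[OF side] by (simp add: x'_def)
  moreover have "gallery (Pi_surface p) (Pi_face p c x') ws s"
    using Cons.prems(2) Pi_face_step[OF side] by (simp add: x'_def w')
  ultimately obtain y where y: "y \<in> faces E" "Pi_face p c y = s"
    "\<And>z. (\<exists>ss. gallery E x' ss z \<and> map (Pi_side p c) ss = ws) \<longleftrightarrow> z = y"
    using Cons.IH by blast
  have "(\<exists>ss. gallery E x ss z \<and> map (Pi_side p c) ss = w # ws) \<longleftrightarrow>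
      (\<exists>ss. gallery E x' ss z \<and> map (Pi_side p c) ss = ws)" (is "?L \<longleftrightarrow> ?R") for z
  proof
    assume ?L
    then obtain t ss where t: "t \<in> sides E" "fst t = x" "gallery E (fst (glue E t)) ss z"
      "Pi_side p c t = w" "map (Pi_side p c) ss = ws"
      by (auto simp: map_eq_Cons_conv)
    have "t = (x, snd t)" "snd t < p" using t by (auto simp: sides_def)
    moreover from this have "(snd t + i) mod p = k" using t(4) w(1) i[of "snd t"] by simp
    ultimately have "t = (x, j)" using uniq by metis
    then show ?R using t by (auto simp: x'_def)
  next
    assume ?R
    then obtain ss where "gallery E x' ss z" "map (Pi_side p c) ss = ws" by blast
    then show ?L using side w' by (intro exI[of _ "(x, j) # ss"]) (simp add: x'_def)
  qed
  then show ?case using y by auto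
qed

lemma gallery_Pi:
  assumes "gallery E x ss y"
  shows "gallery (Pi_surface p) (Pi_face p c x) (map (Pi_side p c) ss) (Pi_face p c y)"
  using assms
proof (induction ss arbitrary: x)
  case Nil
  then have "x \<in> faces E" "x = y" by auto
  then show ?case using Pi_face_in_faces[of x] by simp
next
  case (Cons t ss)
  obtain j where t: "t = (x, j)" "(x, j) \<in> sides E" using Cons.prems by (cases t) auto
  have x: "x \<in> faces E" using t by (simp add: sides_def)
  have "Pi_side p c t \<in> sides (Pi_surface p)" "fst (Pi_side p c t) = Pi_face p c x"
    using Pi_side_eq[OF x] Pi_face_in_faces[OF x] by (auto simp: t sides_def)
  moreover have "gallery E (fst (glue E (x, j))) ss y" using Cons.prems t(1) by simp
  ultimately show ?case using Cons.IH Pi_face_step[OF t(2)] t(1) by fastforce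
qed

section \<open>Monodromy and deck transformations\<close>

lemma sheets_iff: "x \<in> sheets D f0 c \<longleftrightarrow> x \<in> faces E \<and> heading c x ^ p = 1"
  by (auto simp: sheets_def Pi_face_eq)

text \<open>The unfolding is connected: a gallery between two sheets projects to a closed gallery of
  \<open>\<Pi>\<^sub>p\<close> whose monodromy moves one to the other.\<close>

lemma Mon_orbit:
  assumes y: "y \<in> sheets D f0 c"
  shows "(\<lambda>\<mu>. \<mu> y) ` Mon D f0 c = sheets D f0 c"
proof (intro subset_antisym subsetI)
  have yE: "y \<in> faces E" "Pi_face p c y = 1" using y by (auto simp: sheets_def)
  {
    fix z assume "z \<in> (\<lambda>\<mu>. \<mu> y) ` Mon D f0 c"
    then obtain ws where ws: "gallery (Pi_surface p) 1 ws 1" "z = monodromy D f0 c ws y"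
      by (auto simp: Mon_def)
    with lift_gallery[OF yE(1), of ws 1] yE(2) obtain y' where y': "y' \<in> faces E" "Pi_face p c y' = 1"
      "\<And>z. (\<exists>ss. gallery E y ss z \<and> map (Pi_side p c) ss = ws) \<longleftrightarrow> z = y'" by auto
    then have "z = y'" using ws(2) y by (simp add: monodromy_def)
    then show "z \<in> sheets D f0 c" using y' by (simp add: sheets_def)
  next
    fix z assume z: "z \<in> sheets D f0 c"
    then have zE: "z \<in> faces E" "Pi_face p c z = 1" by (auto simp: sheets_def)
    obtain ss where ss: "gallery E y ss z"
      using polygonal_E yE(1) zE(1) unfolding polygonal_surface_def by blast
    define ws where "ws = map (Pi_side p c) ss"
    have ws: "gallery (Pi_surface p) 1 ws 1" using gallery_Pi[OF ss] yE zE by (simp add: ws_def)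
    with lift_gallery[OF yE(1), of ws 1] yE(2) obtain y' where y':
      "\<And>z. (\<exists>ss. gallery E y ss z \<and> map (Pi_side p c) ss = ws) \<longleftrightarrow> z = y'" by auto
    have "z = y'" using y'[of z] ss by (auto simp: ws_def)
    then have "monodromy D f0 c ws y = z" using y y' by (simp add: monodromy_def)
    moreover have "monodromy D f0 c ws \<in> Mon D f0 c" using ws by (simp add: Mon_def)
    ultimately show "z \<in> (\<lambda>\<mu>. \<mu> y) ` Mon D f0 c" by blast
  }
qed

lemma heading_lift: "x = (f, h) \<Longrightarrow> heading c (lift_face D \<sigma> a x) = heading c x / \<zeta> ^ a f"
  by (simp add: heading_def lift_face_def)

text \<open>The lift multiplies the chart coordinate by \<open>\<zeta> ^ a f\<close> and divides the
  heading by the same number; the face of \<open>\<Pi>\<^sub>p\<close> is unchanged because this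
  number has \<open>p\<close>-th power 1.\<close>

lemma lift_in_deck:
  assumes "symmetry E (lift_face D \<sigma> a) (\<lambda>x. a (fst x))"
  shows "rot_map E (lift_face D \<sigma> a) (\<lambda>x. a (fst x)) \<in> deck D f0 c" (is "?F \<in> _")
proof -
  define P where "P = (\<lambda>(x :: 'a \<times> complex, z). pt (Pi_surface p) (Pi_face p c x, heading c x * z / Pi_face p c x))"
  have "proj_Pi p c (?F X) = proj_Pi p c X" if X: "X \<in> points E" for X
  proof -
    obtain x z where "x \<in> faces E" "X = pt E (x, z)" using X by (rule E.pointsE)
    then have sub: "X \<subseteq> faces E \<times> UNIV" using E.pt_in_faces by simp
    have "P (rot_chart E (lift_face D \<sigma> a) (\<lambda>x. a (fst x)) b) = P b" if "b \<in> X" for b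
    proof -
      obtain f h z where b: "b = ((f, h), z)" by (metis surj_pair)
      have fh: "(f, h) \<in> faces E" using sub that b by auto
      then have fh': "lift_face D \<sigma> a (f, h) \<in> faces E" by (rule E.symmetry_faces[OF assms])
      have "Pi_face p c (lift_face D \<sigma> a (f, h)) = Pi_face p c (f, h)"
        by (simp add: Pi_face_eq[OF fh] Pi_face_eq[OF fh'] heading_lift power_divide root_of_unity_power_power)
      then show ?thesis by (simp add: P_def b rot_chart_def heading_lift)
    qed
    then have "P ` ?F X = P ` X" using X by (simp add: rot_map_def image_image)
    then show ?thesis by (simp add: proj_Pi_def P_def)
  qed
  then show ?thesis using E.rot_map_in_Rot[OF assms] by (simp add: deck_def)
qed

text \<open>The centre of \<open>y\<close> determines the image face. An off-centre point determines
  the shift, since its position in \<open>P\<close> must be the same before and after.\<close>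

lemma deck_unique:
  assumes y: "y \<in> sheets D f0 c" "y' \<in> sheets D f0 c"
    and F: "F \<in> deck D f0 c" "F (pt E (y, 0)) = pt E (y', 0)"
  obtains \<tau> b where "symmetry E \<tau> b" "F = rot_map E \<tau> b" "\<tau> y = y'" "\<zeta> ^ b y = heading c y / heading c y'"
proof -
  obtain \<tau> b where \<tau>: "symmetry E \<tau> b" "F = rot_map E \<tau> b"
    using F(1) by (auto simp: deck_def elim: E.RotE)
  have yE: "y \<in> faces E" "y' \<in> faces E" "Pi_face p c y = 1" "Pi_face p c y' = 1"
    using y by (auto simp: sheets_def)
  have single: "pt E (x, z) = {(x, z)}" if "norm z < 1 / 2" for x z
    using pt_interior[of E z x] that gon_ge by simp
  have single': "pt (Pi_surface p) (x, z) = {(x, z)}" if "norm z < 1 / 2" for x z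
    using pt_interior[of "Pi_surface p" z x] that gon_ge by simp
  have "F (pt E (y, 0)) = pt E (\<tau> y, 0)"
    using E.rot_map_pt[OF \<tau>(1) yE(1), of 0] zero_in_polygon[OF gon_ge] \<tau>(2) by simp
  then have \<tau>y: "\<tau> y = y'" using F(2) by (simp add: single)
  define z where "z = interior_point p"
  have z: "z \<in> regular_polygon p" "norm z < 1 / 2" "z \<noteq> 0" using interior_point[OF gon_ge] by (auto simp: z_def)
  have norm_heading: "norm (heading c x) = 1" if "heading c x ^ p = 1" for x :: "'a \<times> complex"
    using ex_root_of_unity_power[OF gon_pos that] by (auto simp: norm_power)
  have n: "norm (heading c y * w) = norm w" "norm (heading c y' * w) = norm w" for w
    using norm_heading y by (simp_all add: sheets_iff norm_mult)
  have "F (pt E (y, z)) = {(y', \<zeta> ^ b y * z)}"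
    using E.rot_map_pt[OF \<tau>(1) yE(1), of z] z \<tau>(2) \<tau>y by (simp add: single norm_mult norm_power)
  then have "proj_Pi p c (F (pt E (y, z))) = {(1, heading c y' * (\<zeta> ^ b y * z))}"
    using z yE(4) single'[of "heading c y' * (\<zeta> ^ b y * z)" 1] n(2)[of "\<zeta> ^ b y * z"]
    by (simp add: proj_Pi_def norm_mult norm_power)
  moreover have "proj_Pi p c (pt E (y, z)) = {(1, heading c y * z)}"
    using z yE(3) single'[of "heading c y * z" 1] n(1)[of z] by (simp add: proj_Pi_def single)
  moreover have "pt E (y, z) \<in> points E" using E.pt_in_points[OF yE(1), of z] z by simp
  ultimately have "heading c y' * \<zeta> ^ b y = heading c y" using F(1) z by (simp add: deck_def)
  moreover have "heading c y' \<noteq> 0" using norm_heading[of y'] y by (auto simp: sheets_iff)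
  ultimately have "\<zeta> ^ b y = heading c y / heading c y'" by (simp add: field_simps)
  with \<tau> \<tau>y show ?thesis by (rule that)
qed

text \<open>Both headings have \<open>p\<close>-th power 1, so \<open>h' / h\<close> is some
  \<open>\<zeta> ^ b\<close>. A rotation of \<open>D\<close> taking side 0 of \<open>f\<close> to
  side \<open>b\<close> of \<open>f'\<close> lifts to the required deck transformation; its
  existence for any two sheets is the normality of the covering.\<close>

lemma deck_of_eq:
  assumes platonic: "platonic_surface D"
    and y: "(f, h) \<in> sheets D f0 c" "\<mu> (f, h) \<in> sheets D f0 c"
  obtains \<sigma> a where "symmetry D \<sigma> a" "\<mu> (f, h) = lift_face D \<sigma> a (f, h)"
    "symmetry E (lift_face D \<sigma> a) (\<lambda>x. a (fst x))"
    "deck_of D f0 c (f, h) \<mu> = rot_map E (lift_face D \<sigma> a) (\<lambda>x. a (fst x))"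
proof -
  obtain f' h' where y': "\<mu> (f, h) = (f', h')" by fastforce
  have fE: "(f, h) \<in> faces E" "(f', h') \<in> faces E" using y y' by (auto simp: sheets_def)
  have h: "h \<noteq> 0" "h' \<noteq> 0" using parallel_nonzero fE by (auto simp: faces_E)
  have "c \<noteq> 0" using horizontal by (auto simp: horizontal_choice_def)
  have "(h' / h) ^ p = heading c (f, h) ^ p / heading c (f', h') ^ p"
    using \<open>c \<noteq> 0\<close> h by (simp add: heading_def power_divide)
  then have "(h' / h) ^ p = 1" using y y' by (simp add: sheets_iff)
  from ex_root_of_unity_power[OF gon_pos this] obtain b where b: "b < p" "h' / h = \<zeta> ^ b" by blast
  have "(f, 0) \<in> sides D" "(f', b) \<in> sides D"
    using fE b parallel_in_faces by (auto simp: faces_E sides_def)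
  from platonic_transitive[OF platonic this] obtain \<sigma> a where
    \<sigma>: "symmetry D \<sigma> a" "\<sigma> f = f'" "a f mod p = b" by (metis add_0)
  have "\<zeta> ^ a f = \<zeta> ^ b" using \<sigma>(3) b by (auto simp: root_of_unity_power_eq_iff)
  then have "h * \<zeta> ^ a f = h'" using b h by (simp add: field_simps)
  then have lift: "lift_face D \<sigma> a (f, h) = (f', h')" using \<sigma>(2) by (simp add: lift_face_def)
  have sym: "symmetry E (lift_face D \<sigma> a) (\<lambda>x. a (fst x))"
    using symmetry_lift[OF \<sigma>(1) fE(1)] lift fE(2) by simp
  let ?F = "rot_map E (lift_face D \<sigma> a) (\<lambda>x. a (fst x))"
  have F: "?F (pt E ((f, h), 0)) = pt E ((f', h'), 0)"
    using E.rot_map_pt[OF sym fE(1), of 0] zero_in_polygon[OF gon_ge] lift by simp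
  have unique: "F = ?F" if F: "F \<in> deck D f0 c" "F (pt E ((f, h), 0)) = pt E ((f', h'), 0)" for F
  proof -
    obtain \<tau> b' where \<tau>: "symmetry E \<tau> b'" "F = rot_map E \<tau> b'" "\<tau> (f, h) = (f', h')"
      "\<zeta> ^ b' (f, h) = heading c (f, h) / heading c (f', h')"
      by (rule deck_unique[OF y(1) y(2)[unfolded y'] F])
    have \<zeta>: "\<zeta> ^ b' (f, h) = \<zeta> ^ a f"
      using \<open>c \<noteq> 0\<close> h(1) unfolding \<tau>(4) heading_def by (simp flip: \<open>h * \<zeta> ^ a f = h'\<close>)
    show ?thesis
      unfolding \<tau>(2) by (rule E.rot_map_eqI[OF \<tau>(1) sym fE(1)]) (simp_all add: \<tau>(3) lift \<zeta>)
  qed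
  have "deck_of D f0 c (f, h) \<mu> = ?F"
    unfolding deck_of_def y' by (rule the_equality) (use lift_in_deck[OF sym] F unique in blast)+
  with \<sigma>(1) _ sym show ?thesis by (rule that) (simp only: lift y')
qed

text \<open>The transport condition says that the face
  \<open>(\<sigma> f, h * \<zeta> ^ a f)\<close> belongs to the unfolding, that is, that the
  direction-preserving lift of the rotation exists.\<close>

lemma phi_deck_Mon:
  assumes platonic: "platonic_surface D" and y: "(f, h) \<in> sheets D f0 c"
  shows "phi D f0 ` deck_of D f0 c (f, h) ` Mon D f0 c =
    {rot_map D \<sigma> a | \<sigma> a. symmetry D \<sigma> a \<and> parallel D f (\<zeta> ^ a f) (\<sigma> f)}" (is "_ = ?H")
proof (intro subset_antisym subsetI)
  have fE: "parallel D f0 h f" using y by (simp add: sheets_def faces_E)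
  have h: "h \<noteq> 0" by (rule parallel_nonzero[OF fE])
  {
    fix G assume "G \<in> phi D f0 ` deck_of D f0 c (f, h) ` Mon D f0 c"
    then obtain \<mu> where \<mu>: "\<mu> \<in> Mon D f0 c" "G = phi D f0 (deck_of D f0 c (f, h) \<mu>)" by blast
    have \<mu>y: "\<mu> (f, h) \<in> sheets D f0 c" using Mon_orbit[OF y] \<mu>(1) by blast
    obtain \<sigma> a where \<sigma>: "symmetry D \<sigma> a" "\<mu> (f, h) = lift_face D \<sigma> a (f, h)"
      "symmetry E (lift_face D \<sigma> a) (\<lambda>x. a (fst x))"
      "deck_of D f0 c (f, h) \<mu> = rot_map E (lift_face D \<sigma> a) (\<lambda>x. a (fst x))"
      using deck_of_eq[of f h \<mu>] platonic y \<mu>y by blast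
    have "parallel D f0 (h * \<zeta> ^ a f) (\<sigma> f)"
      using \<mu>y by (simp add: \<sigma>(2) lift_face_def sheets_def faces_E)
    from parallel_trans[OF parallel_sym[OF fE] this] have "parallel D f (\<zeta> ^ a f) (\<sigma> f)"
      using h by simp
    moreover have "G = rot_map D \<sigma> a" using \<mu>(2) phi_rot_map[OF \<sigma>(1,3)] \<sigma>(4) by simp
    ultimately show "G \<in> ?H" using \<sigma>(1) by blast
  next
    fix G assume "G \<in> ?H"
    then obtain \<sigma> a where \<sigma>: "symmetry D \<sigma> a" "parallel D f (\<zeta> ^ a f) (\<sigma> f)" "G = rot_map D \<sigma> a" by blast
    have "lift_face D \<sigma> a (f, h) \<in> faces E"
      using parallel_trans[OF fE \<sigma>(2)] by (simp add: lift_face_def faces_E)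
    then have "lift_face D \<sigma> a (f, h) \<in> sheets D f0 c"
      using y by (simp add: sheets_iff heading_lift power_divide root_of_unity_power_power)
    then obtain \<mu> where \<mu>: "\<mu> \<in> Mon D f0 c" "\<mu> (f, h) = lift_face D \<sigma> a (f, h)"
      using Mon_orbit[OF y] by (metis (no_types, lifting) imageE)
    have \<mu>y: "\<mu> (f, h) \<in> sheets D f0 c" using Mon_orbit[OF y] \<mu>(1) by blast
    obtain \<tau> b where \<tau>: "symmetry D \<tau> b" "\<mu> (f, h) = lift_face D \<tau> b (f, h)"
      "symmetry E (lift_face D \<tau> b) (\<lambda>x. b (fst x))"
      "deck_of D f0 c (f, h) \<mu> = rot_map E (lift_face D \<tau> b) (\<lambda>x. b (fst x))"
      using deck_of_eq[of f h \<mu>] platonic y \<mu>y by blast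
    have "\<sigma> f = \<tau> f" "\<zeta> ^ a f = \<zeta> ^ b f" using \<mu>(2) \<tau>(2) h by (auto simp: lift_face_def)
    then have "G = rot_map D \<tau> b"
      unfolding \<sigma>(3) using parallel_in_faces[OF fE] by (intro rot_map_eqI[OF \<sigma>(1) \<tau>(1), of f]) auto
    then have "G = phi D f0 (deck_of D f0 c (f, h) \<mu>)" using phi_rot_map[OF \<tau>(1,3)] \<tau>(4) by simp
    then show "G \<in> phi D f0 ` deck_of D f0 c (f, h) ` Mon D f0 c" using \<mu>(1) by blast
  }
qed

end


section \<open>Cosets of the monodromy group\<close>

context surface
begin

lemma parallel_power:
  assumes "parallel D f t f"
  shows "parallel D f (t ^ n) f"
proof (induction n)
  case 0
  show ?case using parallel_in_faces[OF assms] parallel_refl by simp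
qed (simp add: parallel_trans[OF assms])

text \<open>Conjugation by a gallery from \<open>f\<close> to \<open>g\<close> moves the base face;
  its transport cancels because transports commute.\<close>

lemma parallel_symmetry_iff:
  assumes "symmetry D \<sigma> a" "f \<in> faces D" "g \<in> faces D"
    and "parallel D f (\<zeta> ^ a f) (\<sigma> f)"
  shows "parallel D g (\<zeta> ^ a g) (\<sigma> g)"
proof -
  from parallel_connected[OF assms(2,3)] obtain t where t: "parallel D f t g" ..
  have "parallel D g (1 / t * (\<zeta> ^ a f * (t * \<zeta> ^ a g / \<zeta> ^ a f))) (\<sigma> g)"
    using parallel_trans[OF parallel_sym[OF t] parallel_trans[OF assms(4) parallel_symmetry[OF assms(1) t]]] .
  then show ?thesis using parallel_nonzero[OF t] by simp
qed

text \<open>A product of \<open>\<kappa>\<close> in \<open>H\<close> with \<open>\<sigma>\<close>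
  has to be rewritten as a product of some \<open>\<nu>\<close> in \<open>H\<close> with
  \<open>\<tau>\<close>. Transitivity gives a \<open>\<nu>\<close> with the right effect on
  \<open>\<tau> f\<close>, and the holonomy assumption places it in \<open>H\<close>.\<close>

lemma coset_subset:
  assumes platonic: "platonic_surface D"
    and H: "H = {rot_map D \<sigma> a | \<sigma> a. symmetry D \<sigma> a \<and> parallel D f (\<zeta> ^ a f) (\<sigma> f)}"
    and sym: "symmetry D \<sigma> a" "symmetry D \<tau> b"
    and t: "parallel D f t (\<sigma> f)" and u: "parallel D f u (\<tau> f)"
    and hol: "parallel D f ((u / \<zeta> ^ b f) / (t / \<zeta> ^ a f)) f"
  shows "H #>\<^bsub>Rot D\<^esub> rot_map D \<sigma> a \<subseteq> H #>\<^bsub>Rot D\<^esub> rot_map D \<tau> b"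
proof
  fix X assume "X \<in> H #>\<^bsub>Rot D\<^esub> rot_map D \<sigma> a"
  then obtain \<kappa> e where \<kappa>: "symmetry D \<kappa> e" "parallel D f (\<zeta> ^ e f) (\<kappa> f)"
    and X: "X = rot_map D \<kappa> e \<otimes>\<^bsub>Rot D\<^esub> rot_map D \<sigma> a"
    by (auto simp: r_coset_def H)
  have f: "f \<in> faces D" "\<sigma> f \<in> faces D" "\<tau> f \<in> faces D"
    using parallel_in_faces[OF t] parallel_in_faces[OF u] by auto
  have "(\<tau> f, b f mod p) \<in> sides D" "(\<kappa> (\<sigma> f), (a f + e (\<sigma> f)) mod p) \<in> sides D"
    using f symmetry_faces[OF \<kappa>(1)] by (auto simp: sides_def)
  from platonic_transitive[OF platonic this] obtain \<nu> l where
    \<nu>: "symmetry D \<nu> l" "\<nu> (\<tau> f) = \<kappa> (\<sigma> f)" "(b f mod p + l (\<tau> f)) mod p = (a f + e (\<sigma> f)) mod p" .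
  have "\<zeta> ^ (b f + l (\<tau> f)) = \<zeta> ^ (a f + e (\<sigma> f))"
    unfolding root_of_unity_power_eq_iff[OF gon_pos] using \<nu>(3) by (simp add: mod_add_left_eq)
  then have l: "\<zeta> ^ b f * \<zeta> ^ l (\<tau> f) = \<zeta> ^ a f * \<zeta> ^ e (\<sigma> f)" by (simp add: power_add)
  \<comment> \<open>The gallery goes back from \<open>\<tau> f\<close> to \<open>f\<close>, around
    the holonomy loop, on to \<open>\<sigma> f\<close> and from there to
    \<open>\<kappa> (\<sigma> f)\<close>.\<close>
  have "parallel D (\<tau> f) (1 / u * ((u / \<zeta> ^ b f) / (t / \<zeta> ^ a f) * (t * \<zeta> ^ e (\<sigma> f)))) (\<nu> (\<tau> f))"
    unfolding \<nu>(2)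
    by (intro parallel_trans[OF parallel_sym[OF u]] parallel_trans[OF hol] parallel_trans[OF t]
        parallel_symmetry_iff[OF \<kappa>(1) f(1,2) \<kappa>(2)])
  moreover have "1 / u * ((u / \<zeta> ^ b f) / (t / \<zeta> ^ a f) * (t * \<zeta> ^ e (\<sigma> f))) = \<zeta> ^ l (\<tau> f)"
    using l parallel_nonzero[OF t] parallel_nonzero[OF u] by (simp add: field_simps)
  ultimately have "parallel D (\<tau> f) (\<zeta> ^ l (\<tau> f)) (\<nu> (\<tau> f))" by simp
  then have "rot_map D \<nu> l \<in> H"
    using parallel_symmetry_iff[OF \<nu>(1) f(3,1)] \<nu>(1) by (auto simp: H)
  moreover have "X = rot_map D \<nu> l \<otimes>\<^bsub>Rot D\<^esub> rot_map D \<tau> b"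
    unfolding X Rot_mult[OF sym(1) \<kappa>(1)] Rot_mult[OF sym(2) \<nu>(1)]
    by (rule rot_map_eqI[OF symmetry_comp[OF sym(1) \<kappa>(1)] symmetry_comp[OF sym(2) \<nu>(1)] f(1)])
      (simp_all add: \<nu>(2) l power_add)
  ultimately show "X \<in> H #>\<^bsub>Rot D\<^esub> rot_map D \<tau> b" by (auto simp: r_coset_def)
qed

text \<open>Cosets are labelled by exponents of the generator \<open>w\<close> modulo
  \<open>N\<close>. Equal labels mean that the two numbers differ by a power of
  \<open>w ^ N\<close>, which is holonomy, and then the cosets agree.\<close>

lemma card_cosets_le:
  assumes platonic: "platonic_surface D" and f: "f \<in> faces D"
    and H: "H = {rot_map D \<sigma> a | \<sigma> a. symmetry D \<sigma> a \<and> parallel D f (\<zeta> ^ a f) (\<sigma> f)}"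
    and N: "0 < N" and hol: "parallel D f (w ^ N) f"
    and gen: "\<And>u. signed_root p u \<Longrightarrow> \<exists>n. u = w ^ n"
  shows "finite (rcosets\<^bsub>Rot D\<^esub> H) \<and> card (rcosets\<^bsub>Rot D\<^esub> H) \<le> N"
proof -
  \<comment> \<open>A relation, since the label may vary with the representative, the gallery and
    the exponent; the point is that one label never belongs to two cosets.\<close>
  define R where "R Q r \<longleftrightarrow> (\<exists>\<sigma> a t n. symmetry D \<sigma> a \<and> Q = H #>\<^bsub>Rot D\<^esub> rot_map D \<sigma> a \<and>
    parallel D f t (\<sigma> f) \<and> t / \<zeta> ^ a f = w ^ n \<and> r = n mod N)" for Q r
  have ex: "\<exists>r<N. R Q r" if "Q \<in> rcosets\<^bsub>Rot D\<^esub> H" for Q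
  proof -
    obtain F where F: "F \<in> carrier (Rot D)" "Q = H #>\<^bsub>Rot D\<^esub> F" using \<open>Q \<in> _\<close> by (auto simp: RCOSETS_def)
    from RotE[OF F(1)] obtain \<sigma> a where \<sigma>: "symmetry D \<sigma> a" "F = rot_map D \<sigma> a" .
    from parallel_connected[OF f symmetry_faces[OF \<sigma>(1) f]] obtain t where t: "parallel D f t (\<sigma> f)" ..
    from parallel_value[OF t] obtain i j where "t = (- 1) ^ i * \<zeta> ^ j" by blast
    then have "signed_root p t" by (simp add: signed_root_power)
    moreover have "signed_root p (\<zeta> ^ a f)" by (simp add: signed_root_def root_of_unity_power_power)
    ultimately obtain n where "t / \<zeta> ^ a f = w ^ n" using gen signed_root_divide by blast
    then have "R Q (n mod N)" unfolding R_def using \<sigma> F(2) t by blast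
    then show ?thesis using N by (intro exI[of _ "n mod N"]) simp
  qed
  have le: "Q \<subseteq> Q'" if RQ: "R Q r" "R Q' r" for Q Q' r
  proof -
    obtain \<sigma> a t m where 1: "symmetry D \<sigma> a" "Q = H #>\<^bsub>Rot D\<^esub> rot_map D \<sigma> a"
      "parallel D f t (\<sigma> f)" "t / \<zeta> ^ a f = w ^ m" "r = m mod N" using RQ(1) by (auto simp: R_def)
    obtain \<tau> b u n where 2: "symmetry D \<tau> b" "Q' = H #>\<^bsub>Rot D\<^esub> rot_map D \<tau> b"
      "parallel D f u (\<tau> f)" "u / \<zeta> ^ b f = w ^ n" "r = n mod N" using RQ(2) by (auto simp: R_def)
    have w: "w ^ N \<noteq> 0" using parallel_nonzero[OF hol] .
    then have "w \<noteq> 0" using N by auto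
    have split: "w ^ i = (w ^ N) ^ (i div N) * w ^ (i mod N)" for i
      by (metis mult_div_mod_eq power_add power_mult)
    have "parallel D f ((w ^ N) ^ (n div N) * (1 / (w ^ N) ^ (m div N))) f"
      by (intro parallel_trans[OF parallel_power[OF hol]] parallel_sym[OF parallel_power[OF hol]])
    moreover have "(w ^ N) ^ (n div N) * (1 / (w ^ N) ^ (m div N)) = w ^ n / w ^ m"
      using split[of n] split[of m] 1(5) 2(5) \<open>w \<noteq> 0\<close> w by simp
    ultimately show ?thesis
      unfolding 1(2) 2(2) using 1(4) 2(4)
      by (intro coset_subset[OF platonic H 1(1) 2(1) 1(3) 2(3)]) simp
  qed
  define \<rho> where "\<rho> Q = (SOME r. r < N \<and> R Q r)" for Q
  have \<rho>: "\<rho> Q < N \<and> R Q (\<rho> Q)" if "Q \<in> rcosets\<^bsub>Rot D\<^esub> H" for Q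
    unfolding \<rho>_def by (rule someI_ex) (use ex[OF that] in blast)
  have "inj_on \<rho> (rcosets\<^bsub>Rot D\<^esub> H)"
  proof (rule inj_onI)
    fix Q Q' assume *: "Q \<in> rcosets\<^bsub>Rot D\<^esub> H" "Q' \<in> rcosets\<^bsub>Rot D\<^esub> H" "\<rho> Q = \<rho> Q'"
    then have "R Q (\<rho> Q)" "R Q' (\<rho> Q)" using \<rho> by metis+
    then show "Q = Q'" using le by blast
  qed
  moreover have "\<rho> ` (rcosets\<^bsub>Rot D\<^esub> H) \<subseteq> {..<N}" using \<rho> by auto
  ultimately show ?thesis
    using inj_on_finite[of \<rho> _ "{..<N}"] card_inj_on_le[of \<rho> _ "{..<N}"] by simp
qed

end

section \<open>Generators and indices\<close>

text \<open>Bezout with natural coefficients, the multiple of \<open>n\<close> being killed by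
  \<open>w ^ n = 1\<close>. It replaces the known holonomy by a smaller power of the
  generator.\<close>

lemma power_gcd:
  fixes w :: complex
  assumes "w ^ n = 1"
  shows "\<exists>x. (w ^ m) ^ x = w ^ gcd m n"
proof (cases "m = 0")
  case True
  then show ?thesis using assms by simp
next
  case False
  then obtain x y where "m * x = n * y + gcd m n" using bezout_nat by blast
  then have "(w ^ m) ^ x = w ^ gcd m n"
    using assms by (metis mult_1 power_add power_mult power_one)
  then show ?thesis by blast
qed

lemma root_of_unity_half:
  assumes "even p" "0 < p"
  shows "root_of_unity p ^ (p div 2) = - 1"
proof -
  have "root_of_unity p ^ (p div 2) \<noteq> root_of_unity p ^ 0"
    unfolding root_of_unity_power_eq_iff[OF assms(2)] using assms by auto
  moreover have "root_of_unity p ^ (p div 2) * root_of_unity p ^ (p div 2) = 1"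
    using assms root_of_unity_power_gon[of p] by (simp flip: power_add mult_2)
  ultimately show ?thesis by (simp add: square_eq_1_iff)
qed

lemma signed_root_generator_even:
  assumes "even p" "0 < p" "signed_root p u"
  shows "\<exists>n. u = root_of_unity p ^ n"
  using ex_root_of_unity_power[OF assms(2), of u] assms by (auto simp: signed_root_def)

text \<open>For odd \<open>p\<close> the \<open>p\<close>-th power of \<open>- \<zeta>\<close> is
  \<open>- 1\<close> and its next power is \<open>\<zeta>\<close>, so both generators are
  recovered.\<close>

lemma signed_root_generator_odd:
  assumes "odd p" "signed_root p u"
  shows "\<exists>n. u = (- root_of_unity p) ^ n"
proof -
  have p: "0 < p" using assms(1) by (rule odd_pos)
  have minus: "(- root_of_unity p) ^ p = - 1"
    using assms(1) root_of_unity_power_gon[OF p] by simp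
  have "(- root_of_unity p) ^ (p + 1) = root_of_unity p"
    unfolding power_add minus by simp
  then have pow: "root_of_unity p ^ j = (- root_of_unity p) ^ ((p + 1) * j)" for j
    by (simp only: power_mult)
  consider "u ^ p = 1" | "(- u) ^ p = 1" using assms by (auto simp: signed_root_def)
  then show ?thesis
  proof cases
    case 1
    then show ?thesis using ex_root_of_unity_power[OF p] pow by metis
  next
    case 2
    then obtain j where "- u = root_of_unity p ^ j" using ex_root_of_unity_power[OF p] by blast
    then have "u = - (root_of_unity p ^ j)" by (metis minus_minus)
    then have "u = (- root_of_unity p) ^ (p + (p + 1) * j)"
      unfolding power_add minus pow[symmetric] by simp
    then show ?thesis by blast
  qed
qed

lemma gcd_double_le:
  assumes "0 < (p :: nat)"
  shows "gcd q (2 * p) \<le> 2 * gcd p q"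
proof (rule dvd_imp_le)
  have "gcd q (2 * p) dvd gcd (2 * p) (2 * q)" by auto
  then show "gcd q (2 * p) dvd 2 * gcd p q" by (simp add: gcd_mult_distrib_nat)
qed (use assms in simp)

lemma gcd_double_odd: "odd q \<Longrightarrow> gcd q (2 * p) = gcd p (q :: nat)"
  using gcd_mult_left_left_cancel[of q 2 p] by (simp add: gcd.commute[of q])

text \<open>For \<open>p = 4 * k\<close> the factor is \<open>1 + 2 * k\<close>, which is odd and
  coprime to \<open>2 * k\<close>, hence coprime to \<open>p\<close>.\<close>

lemma gcd_mod4_0:
  assumes "p mod 4 = (0 :: nat)"
  shows "gcd ((1 + p div 2) * q) p = gcd p q"
proof -
  obtain k where k: "p = 4 * k" using assms by auto
  have "coprime (1 + 2 * k) (2 * (2 * k))"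
    by (metis coprime_add_one_right coprime_commute coprime_mult_right_iff add.commute)
  then have "coprime (1 + p div 2) p" by (simp add: k)
  then show ?thesis using gcd_mult_left_left_cancel[of p "1 + p div 2" q]
    by (simp only: coprime_commute gcd.commute)
qed

text \<open>For \<open>p = 2 * m\<close> the gcd divides \<open>2 * m * q\<close> and
  \<open>2 * (1 + m) * q\<close>, hence \<open>2 * q\<close>, and so \<open>2 * gcd m q\<close>. As
  \<open>m\<close> is odd, this is \<open>gcd p q\<close> when \<open>q\<close> is even.\<close>

lemma gcd_mod4_2:
  assumes "p mod 4 = (2 :: nat)"
  shows "gcd ((1 + p div 2) * q) p \<le> (if even q then gcd p q else 2 * gcd p q)"
proof -
  define m where "m = p div 2"
  have p: "p = 2 * m" "odd m" "0 < m" using assms unfolding m_def by presburger+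
  let ?N = "gcd ((1 + m) * q) p"
  have "?N dvd 2 * ((1 + m) * q)" "?N dvd 2 * m * q"
    unfolding p(1) by (rule dvd_mult[OF gcd_dvd1], rule dvd_mult2[OF gcd_dvd2])
  moreover have "2 * ((1 + m) * q) = 2 * m * q + 2 * q" by (simp add: algebra_simps)
  ultimately have "?N dvd 2 * q" by (metis dvd_add_right_iff)
  then have N: "?N dvd 2 * gcd m q" by (simp add: gcd_mult_distrib_nat p)
  show ?thesis
  proof (cases "even q")
    case True
    then obtain r where q: "q = 2 * r" by blast
    have "gcd m q = gcd m r" using p(2) by (simp add: q gcd_mult_right_left_cancel)
    then have "2 * gcd m q = gcd p q" by (simp add: p(1) q gcd_mult_distrib_nat)
    then show ?thesis using True N dvd_imp_le[OF N] p by (simp add: m_def[symmetric])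
  next
    case False
    have "gcd m q \<le> gcd p q" using p by (intro dvd_imp_le) auto
    then show ?thesis using False dvd_imp_le[OF N] p by (simp add: m_def[symmetric])
  qed
qed

theorem corollary4p5:
  fixes D :: "'f poly_surface" and p q d :: nat
    and f0 :: 'f and c :: complex and y :: "'f \<times> complex"
  assumes "platonic_surface D" and "schlafli_symbol D p q" and "d = gcd p q"
    and "f0 \<in> faces D" and "horizontal_choice D f0 c" and "y \<in> sheets D f0 c"
  shows "finite (carrier (Rot_mod_Mon D f0 c y)) \<and>
    (odd p \<and> odd q \<longrightarrow> order (Rot_mod_Mon D f0 c y) \<le> d) \<and>
    (odd p \<and> even q \<longrightarrow> order (Rot_mod_Mon D f0 c y) \<le> 2 * d) \<and>
    (p mod 4 = 0 \<longrightarrow> order (Rot_mod_Mon D f0 c y) \<le> d) \<and>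
    (p mod 4 = 2 \<and> odd q \<longrightarrow> order (Rot_mod_Mon D f0 c y) \<le> 2 * d) \<and>
    (p mod 4 = 2 \<and> even q \<longrightarrow> order (Rot_mod_Mon D f0 c y) \<le> d)"
proof -
  interpret horizontal_unfolding D f0 c
    using assms platonic_polygonal by unfold_locales auto
  have p: "gon D = p" using assms(2) by (simp add: schlafli_symbol_def)
  have p0: "0 < p" using gon_pos p by simp
  obtain f h where y: "y = (f, h)" by fastforce
  have f: "f \<in> faces D" using assms(6) parallel_in_faces by (auto simp: y sheets_def faces_E)
  define H where "H = phi D f0 ` deck_of D f0 c y ` Mon D f0 c"
  have H: "H = {rot_map D \<sigma> a | \<sigma> a. symmetry D \<sigma> a \<and> parallel D f (root_of_unity (gon D) ^ a f) (\<sigma> f)}"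
    unfolding H_def y by (rule phi_deck_Mon) (use assms y in auto)
  have carrier: "carrier (Rot_mod_Mon D f0 c y) = rcosets\<^bsub>Rot D\<^esub> H"
    by (simp add: Rot_mod_Mon_def FactGroup_def H_def)
  have hol: "parallel D f (((- root_of_unity p) ^ q) ^ x) f" for x
    using parallel_power[OF vertex_holonomy[OF assms(2) f]] p by simp
  have bound: "finite (carrier (Rot_mod_Mon D f0 c y)) \<and> order (Rot_mod_Mon D f0 c y) \<le> N"
    if "0 < N" "parallel D f (w ^ N) f" "\<And>u. signed_root p u \<Longrightarrow> \<exists>n. u = w ^ n" for w N
    unfolding order_def carrier using card_cosets_le[OF assms(1) f H that(1,2)] that(3) p by simp
  show ?thesis
  proof (cases "odd p")
    case True
    \<comment> \<open>The modulus \<open>2 * p\<close> is an exponent killing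
      \<open>- \<zeta>\<close>.\<close>
    define N where "N = gcd q (2 * p)"
    have "(- root_of_unity p) ^ (2 * p) = root_of_unity p ^ (p * 2)" by (simp add: mult.commute)
    also have "\<dots> = 1" by (simp only: power_mult root_of_unity_power_gon[OF p0] power_one)
    finally obtain x where "((- root_of_unity p) ^ q) ^ x = (- root_of_unity p) ^ N"
      using power_gcd unfolding N_def by blast
    then have "parallel D f ((- root_of_unity p) ^ N) f" using hol by metis
    then have "finite (carrier (Rot_mod_Mon D f0 c y)) \<and> order (Rot_mod_Mon D f0 c y) \<le> N"
      using p0 by (intro bound[OF _ _ signed_root_generator_odd[OF True]]) (auto simp: N_def)
    moreover have "N \<le> 2 * d" using gcd_double_le[OF p0] by (simp add: N_def assms(3))
    moreover have "odd q \<Longrightarrow> N = d" using gcd_double_odd by (simp add: N_def assms(3))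
    moreover have "p mod 4 \<noteq> 0" "p mod 4 \<noteq> 2" using True by presburger+
    ultimately show ?thesis by auto
  next
    case False
    \<comment> \<open>The factor \<open>1 + p div 2\<close> is the exponent that expresses
      \<open>- \<zeta>\<close> by \<open>\<zeta>\<close>.\<close>
    define N where "N = gcd ((1 + p div 2) * q) p"
    have "- root_of_unity p = root_of_unity p ^ (1 + p div 2)"
      using root_of_unity_half False p0 by simp
    then have "(- root_of_unity p) ^ q = root_of_unity p ^ ((1 + p div 2) * q)"
      by (simp only: power_mult)
    moreover obtain x where "(root_of_unity p ^ ((1 + p div 2) * q)) ^ x = root_of_unity p ^ N"
      using power_gcd[OF root_of_unity_power_gon[OF p0]] unfolding N_def by blast
    ultimately have "parallel D f (root_of_unity p ^ N) f" using hol by metis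
    then have "finite (carrier (Rot_mod_Mon D f0 c y)) \<and> order (Rot_mod_Mon D f0 c y) \<le> N"
      using False p0 by (intro bound[OF _ _ signed_root_generator_even[OF _ p0]]) (auto simp: N_def)
    moreover have "p mod 4 = 0 \<Longrightarrow> N = d" using gcd_mod4_0 by (simp add: N_def assms(3))
    moreover have "p mod 4 = 2 \<Longrightarrow> N \<le> (if even q then d else 2 * d)"
      unfolding N_def assms(3) by (rule gcd_mod4_2)
    ultimately show ?thesis using False by auto
  qed
qed

end
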